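(* Let $k=(k_1,k_2)\in\mathbb{C}^2$ and let $\mathbb{D}_{\mathrm{ns}}(k)$ be the commutant of $\widetilde{D}_k$ in $(\mathbb{D}_{\mathfrak{R}}\otimes\mathbb{M}_2)^{\mathbb{Z}_2}$. Then $$\mathrm{diag}\circ\gamma_{\mathrm{ns}}(k):\mathbb{D}_{\mathrm{ns}}(k)\to(S(\mathfrak{h})\otimes\mathbb{C}^2)^{\mathbb{Z}_2}$$ is a well-defined algebra isomorphism. Moreover, the composition $$\gamma_{\mathrm{HC}}(k):=\pi_1\circ(\mathrm{diag}\circ\gamma_{\mathrm{ns}}(k)):\mathbb{D}_{\mathrm{ns}}(k)\to S(\mathfrak{h})$$ is an algebra isomorphism.
   Context: Write $z=e^{\epsilon}$, $\partial_\xi=z\,d/dz$. Let $\mathfrak{h}=\mathbb{C}\xi$, $\epsilon(\xi)=1$, $S(\mathfrak{h})=\mathbb{C}[\xi]$. $\mathbb{Z}_2=\{1,s\}$ acts by $s(e^{n\epsilon})=e^{-n\epsilon}$, $s(\xi)=-\xi$. $\mathfrak{R}$ is the unital algebra generated by $(1-e^{-\epsilon})^{-1}$ and $(1-e^{-2\epsilon})^{-1}$ (it is $s$-stable), and $\mathbb{D}_{\mathfrak{R}}=\mathfrak{R}\otimes\mathbb{C}[\partial_\xi]$ is the algebra of differential operators with coefficients in $\mathfrak{R}$, with action $s(f\otimes p(\partial_\xi))=s(f)\otimes p(-\partial_\xi)$. $\mathbb{M}_2$ denotes complex $2\times2$ matrices. $\mathbb{Z}_2$ acts on $\mathbb{D}_{\mathfrak{R}}\otimes\mathbb{M}_2$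 by $s(D\otimes A)=s(D)\otimes\pi(s)A\pi(s)^{-1}$ with $\pi(s)=\begin{pmatrix}0&1\\1&0\end{pmatrix}$; $(\cdot)^{\mathbb{Z}_2}$ denotes invariants. Put $\rho(k)=\frac12(k_1+2k_2)$ and $$\widetilde{D}_k=\begin{pmatrix}\partial_\xi+\frac{k_1}{1-e^{-\epsilon}}+\frac{2k_2}{1-e^{-2\epsilon}}-\rho(k)&-\frac{k_1}{1-e^{-\epsilon}}-\frac{2k_2}{1-e^{-2\epsilon}}\\-\frac{k_1}{1-e^{\epsilon}}-\frac{2k_2}{1-e^{2\epsilon}}&-\partial_\xi-\frac{k_1}{1-e^{-\epsilon}}-\frac{2k_2}{1-e^{-2\epsilon}}+\rho(k)\end{pmatrix}.$$ The Harish-Chandra homomorphism $\gamma(k):\mathbb{D}_{\mathfrak{R}}\to S(\mathfrak{h})$ is the unique algebra homomorphism with $(1-e^{-\epsilon})^{-1}\mapsto1$, $(1-e^{-2\epsilon})^{-1}\mapsto1$, $\partial_\xi\mapsto\xi-\rho(k)$, and $\gamma_{\mathrm{ns}}(k):\mathbb{D}_{\mathfrak{R}}\otimes\mathbb{M}_2\to S(\mathfrak{h})\otimes\mathbb{M}_2$ is $\gamma(k)$ applied entrywise. $\mathrm{diag}:S(\mathfrak{h})\otimes\mathbb{M}_2\to S(\mathfrak{h})\otimes\mathbb{C}^2$ is $P\mapsto(P_{11},P_{22})$, where $S(\mathfrak{h})\otimes\mathbb{C}^2$ has the componentwise product, and $\mathbb{Z}_2$ acts on $S(\mathfrak{h})\otimes\mathbb{C}^2$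 by $s(P_1,P_2)=(s(P_2),s(P_1))$. $\pi_1$ is the projection on the first component. *)

theory Defs
  imports
    "HOL-Analysis.Analysis"
    "HOL-Computational_Algebra.Fraction_Field"
    "HOL-Algebra.Module"
begin

section \<open>Associative unital complex algebras\<close>

text \<open>The locale \<open>algebra\<close> of HOL-Algebra only covers commutative algebras.\<close>

locale complex_algebra = ring A for A :: "(complex, 'a, 'm) module_scheme" (structure) +
  assumes smult_closed: "x \<in> carrier A \<Longrightarrow> c \<odot> x \<in> carrier A"
    and smult_l_distr: "x \<in> carrier A \<Longrightarrow> (c + d) \<odot> x = c \<odot> x \<oplus> d \<odot> x"
    and smult_r_distr: "x \<in> carrier A \<Longrightarrow> y \<in> carrier A \<Longrightarrow> c \<odot> (x \<oplus> y) = c \<odot> x \<oplus> c \<odot> y"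
    and smult_assoc: "x \<in> carrier A \<Longrightarrow> (c * d) \<odot> x = c \<odot> (d \<odot> x)"
    and smult_one: "x \<in> carrier A \<Longrightarrow> 1 \<odot> x = x"
    and smult_mult_left: "x \<in> carrier A \<Longrightarrow> y \<in> carrier A \<Longrightarrow> (c \<odot> x) \<otimes> y = c \<odot> (x \<otimes> y)"
    and smult_mult_right: "x \<in> carrier A \<Longrightarrow> y \<in> carrier A \<Longrightarrow> x \<otimes> (c \<odot> y) = c \<odot> (x \<otimes> y)"

text \<open>Membership in \<open>ring_hom\<close> includes preservation of the unit and
  \<open>carrier A \<rightarrow> carrier B\<close>, i.e. that the map is well defined.\<close>

definition calg_hom ::
  "(complex, 'a, 'm) module_scheme \<Rightarrow> (complex, 'b, 'n) module_scheme \<Rightarrow> ('a \<Rightarrow> 'b) set" where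
  "calg_hom A B = {f \<in> ring_hom A B. \<forall>c. \<forall>x \<in> carrier A. f (c \<odot>\<^bsub>A\<^esub> x) = c \<odot>\<^bsub>B\<^esub> f x}"

definition calg_iso ::
  "(complex, 'a, 'm) module_scheme \<Rightarrow> (complex, 'b, 'n) module_scheme \<Rightarrow> ('a \<Rightarrow> 'b) set" where
  "calg_iso A B = {f \<in> calg_hom A B. bij_betw f (carrier A) (carrier B)}"

lemma complex_algebra_subalgebra:
  fixes A (structure)
  assumes A: "complex_algebra A" and S: "S \<subseteq> carrier A" "\<one> \<in> S"
    and add: "\<And>x y. x \<in> S \<Longrightarrow> y \<in> S \<Longrightarrow> x \<oplus> y \<in> S"
    and mult: "\<And>x y. x \<in> S \<Longrightarrow> y \<in> S \<Longrightarrow> x \<otimes> y \<in> S"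
    and scale: "\<And>c x. x \<in> S \<Longrightarrow> c \<odot> x \<in> S"
  shows "complex_algebra (A\<lparr>carrier := S\<rparr>)"
proof -
  interpret A: complex_algebra A by (rule A)
  have zero: "(0::complex) \<odot> x = \<zero>" if "x \<in> carrier A" for x
    using A.smult_l_distr[OF that, of 0 0] A.smult_closed[OF that, of 0]
    by (metis A.add.l_cancel_one' add.right_neutral)
  have zS: "\<zero> \<in> S" using zero[of \<one>] scale[OF S(2), of 0] by auto
  have neg: "(-1::complex) \<odot> x \<oplus> x = \<zero>" if "x \<in> carrier A" for x
    using A.smult_l_distr[OF that, of "-1" 1] A.smult_one[OF that] zero[OF that] by simp
  have memb: "x \<in> carrier A" if "x \<in> S" for x using S that by blast
  have ex_neg: "\<exists>y\<in>S. y \<oplus> x = \<zero>" if "x \<in> S" for x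
    using neg[OF memb[OF that]] scale[OF that] by blast
  have "ring (A\<lparr>carrier := S\<rparr>)"
    by (rule ringI; (rule abelian_groupI monoid.intro)?)
      (use memb zS S ex_neg in \<open>auto simp: add mult A.a_assoc A.m_assoc A.l_distr A.r_distr
        intro: A.a_comm\<close>)
  then show ?thesis
    by (rule complex_algebra.intro, unfold_locales)
      (auto simp: memb scale A.smult_l_distr A.smult_r_distr A.smult_assoc A.smult_one
        A.smult_mult_left A.smult_mult_right)
qed


section \<open>Rational functions in \<open>z\<close>\<close>

type_synonym ratfun = "complex poly fract"

definition rf_const :: "complex \<Rightarrow> ratfun" where
  "rf_const c = Fract [:c:] 1"

definition zz :: ratfun where
  "zz = Fract [:0, 1:] 1"

text \<open>The derivation \<open>z d/dz\<close>, by the quotient rule; the value does not depend on the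
  representation of the fraction.\<close>

definition rf_deriv :: "ratfun \<Rightarrow> ratfun" where
  "rf_deriv f = (THE g. \<exists>p q. q \<noteq> 0 \<and> f = Fract p q \<and>
     g = zz * Fract (pderiv p * q - p * pderiv q) (q ^ 2))"

lemma rf_deriv_Fract:
  assumes q: "q \<noteq> 0"
  shows "rf_deriv (Fract p q) = zz * Fract (pderiv p * q - p * pderiv q) (q ^ 2)"
  unfolding rf_deriv_def
proof (rule the_equality)
  fix g assume "\<exists>p' q'. q' \<noteq> 0 \<and> Fract p q = Fract p' q' \<and>
    g = zz * Fract (pderiv p' * q' - p' * pderiv q') (q' ^ 2)"
  then obtain c d where d: "d \<noteq> 0" and pq: "Fract p q = Fract c d"
    and g: "g = zz * Fract (pderiv c * d - c * pderiv d) (d ^ 2)" by blast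
  have e: "p * d = c * q" using pq q d by (simp add: eq_fract)
  have e': "pderiv p * d + p * pderiv d = pderiv c * q + c * pderiv q"
    using arg_cong[OF e, of pderiv] by (simp add: pderiv_mult algebra_simps)
  have "(pderiv p * q - p * pderiv q) * d\<^sup>2 - (pderiv c * d - c * pderiv d) * q\<^sup>2 =
     q * d * (pderiv p * d - pderiv c * q) - (p * d) * pderiv q * d + (c * q) * pderiv d * q"
    by (simp add: algebra_simps power2_eq_square)
  also have "\<dots> = q * d * (pderiv p * d - pderiv c * q) - (c * q) * pderiv q * d + (p * d) * pderiv d * q"
    by (simp only: e)
  also have "\<dots> = q * d * ((pderiv p * d + p * pderiv d) - (pderiv c * q + c * pderiv q))"
    by (simp add: algebra_simps)
  also have "\<dots> = 0" by (simp add: e')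
  finally have "(pderiv p * q - p * pderiv q) * d\<^sup>2 = (pderiv c * d - c * pderiv d) * q\<^sup>2" by simp
  with q d show "g = zz * Fract (pderiv p * q - p * pderiv q) (q ^ 2)"
    by (simp add: g eq_fract)
qed (use q in blast)

text \<open>The automorphism \<open>s\<close>, i.e. the substitution \<open>z \<mapsto> z\<^sup>-\<^sup>1\<close>.\<close>

definition poly_at_inv :: "complex poly \<Rightarrow> ratfun" where
  "poly_at_inv p = poly (map_poly rf_const p) (inverse zz)"

lemma rf_const_0 [simp]: "rf_const 0 = 0"
  and rf_const_1 [simp]: "rf_const 1 = 1"
  and rf_const_add: "rf_const (c + d) = rf_const c + rf_const d"
  and rf_const_mult: "rf_const (c * d) = rf_const c * rf_const d"
  by (simp_all add: rf_const_def fract_collapse one_pCons[symmetric] mult.commute)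

lemma poly_at_inv_pCons: "poly_at_inv (pCons c p) = rf_const c + inverse zz * poly_at_inv p"
  by (simp add: poly_at_inv_def map_poly_pCons)

lemma poly_at_inv_0 [simp]: "poly_at_inv 0 = 0"
  by (simp add: poly_at_inv_def)

lemma poly_at_inv_add: "poly_at_inv (p + q) = poly_at_inv p + poly_at_inv q"
  by (induction p q rule: poly_induct2) (simp_all add: poly_at_inv_pCons rf_const_add algebra_simps)

lemma poly_at_inv_smult: "poly_at_inv (Polynomial.smult c p) = rf_const c * poly_at_inv p"
  by (induction p) (simp_all add: poly_at_inv_pCons rf_const_mult algebra_simps)

lemma poly_at_inv_mult: "poly_at_inv (p * q) = poly_at_inv p * poly_at_inv q"
  by (induction p)
    (simp_all add: poly_at_inv_pCons poly_at_inv_add poly_at_inv_smult algebra_simps)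

lemma zz_nonzero [simp]: "zz \<noteq> 0"
  by (simp add: zz_def fract_expand eq_fract)

lemma poly_at_inv_eq_reflect:
  "zz ^ degree p * poly_at_inv p = Fract (reflect_poly p) 1"
proof -
  have at_zz: "poly (map_poly rf_const q) zz = Fract q 1" for q :: "complex poly"
    by (induction q) (auto simp: map_poly_pCons fract_collapse rf_const_def zz_def)
  have inj: "rf_const c = 0 \<longleftrightarrow> c = 0" for c
    by (simp add: rf_const_def fract_expand eq_fract)
  have deg: "degree (map_poly rf_const p) = degree p"
    by (cases "p = 0") (simp_all add: map_poly_degree_eq inj)
  have refl: "reflect_poly (map_poly rf_const p) = map_poly rf_const (reflect_poly p)"
    by (rule poly_eqI) (simp add: coeff_reflect_poly coeff_map_poly deg)
  show ?thesis
    using poly_reflect_poly_nz[OF zz_nonzero, of "map_poly rf_const p"]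
    by (simp add: poly_at_inv_def deg refl at_zz)
qed

lemma poly_at_inv_eq_0_iff [simp]: "poly_at_inv p = 0 \<longleftrightarrow> p = 0"
proof
  assume "poly_at_inv p = 0"
  then have "Fract (reflect_poly p) 1 = 0"
    using poly_at_inv_eq_reflect[of p] by simp
  then show "p = 0" by (simp add: fract_expand eq_fract)
qed simp

definition rf_s :: "ratfun \<Rightarrow> ratfun" where
  "rf_s f = (THE g. \<exists>p q. q \<noteq> 0 \<and> f = Fract p q \<and> g = poly_at_inv p / poly_at_inv q)"

lemma rf_s_Fract:
  assumes q: "q \<noteq> 0"
  shows "rf_s (Fract p q) = poly_at_inv p / poly_at_inv q"
  unfolding rf_s_def
proof (rule the_equality)
  fix g assume "\<exists>p' q'. q' \<noteq> 0 \<and> Fract p q = Fract p' q' \<and> g = poly_at_inv p' / poly_at_inv q'"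
  then obtain c d where d: "d \<noteq> 0" and pq: "Fract p q = Fract c d"
    and g: "g = poly_at_inv c / poly_at_inv d" by blast
  have "p * d = c * q" using pq q d by (simp add: eq_fract)
  then have "poly_at_inv p * poly_at_inv d = poly_at_inv c * poly_at_inv q"
    by (metis poly_at_inv_mult)
  then show "g = poly_at_inv p / poly_at_inv q"
    using q d by (simp add: g field_simps)
qed (use q in blast)

lemma rf_deriv_const [simp]: "rf_deriv (rf_const c) = 0"
  by (simp add: rf_const_def rf_deriv_Fract fract_collapse)

lemma Fract_pCons: "Fract (pCons a p) 1 = rf_const a + zz * Fract p 1"
  by (simp add: rf_const_def zz_def)

lemma poly_at_inv_1 [simp]: "poly_at_inv 1 = 1"
  using poly_at_inv_pCons[of 1 0] by (simp add: one_pCons)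

lemma rf_s_poly: "rf_s (Fract p 1) = poly_at_inv p"
  by (simp add: rf_s_Fract)

lemma ratfun_cases:
  obtains p q where "q \<noteq> 0" "Fract q 1 \<noteq> 0" "f = Fract p 1 / Fract q 1"
  by (cases f) (auto simp: fract_expand eq_fract)

lemma rf_deriv_0 [simp]: "rf_deriv 0 = 0" and rf_deriv_1 [simp]: "rf_deriv 1 = 0"
  using rf_deriv_const[of 0] rf_deriv_const[of 1] by simp_all

lemma rf_deriv_add: "rf_deriv (f + g) = rf_deriv f + rf_deriv g"
proof (cases f; cases g)
  fix a b c d :: "complex poly"
  assume *: "f = Fract a b" "b \<noteq> 0" "g = Fract c d" "d \<noteq> 0"
  have "Fract (pderiv (a * d + c * b) * (b * d) - (a * d + c * b) * pderiv (b * d)) ((b * d)\<^sup>2)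
     = Fract (pderiv a * b - a * pderiv b) (b\<^sup>2) + Fract (pderiv c * d - c * pderiv d) (d\<^sup>2)"
    using * by (simp add: eq_fract pderiv_mult pderiv_add power2_eq_square algebra_simps)
  then have "zz * Fract (pderiv (a * d + c * b) * (b * d) - (a * d + c * b) * pderiv (b * d)) ((b * d)\<^sup>2)
     = zz * (Fract (pderiv a * b - a * pderiv b) (b\<^sup>2) + Fract (pderiv c * d - c * pderiv d) (d\<^sup>2))"
    by (rule arg_cong)
  also have "\<dots> = rf_deriv f + rf_deriv g"
    by (simp only: * rf_deriv_Fract[OF *(2)] rf_deriv_Fract[OF *(4)] distrib_left)
  finally show ?thesis using * by (simp add: rf_deriv_Fract)
qed

lemma rf_deriv_mult: "rf_deriv (f * g) = rf_deriv f * g + f * rf_deriv g"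
proof (cases f; cases g)
  fix a b c d :: "complex poly"
  assume *: "f = Fract a b" "b \<noteq> 0" "g = Fract c d" "d \<noteq> 0"
  have "Fract (pderiv (a * c) * (b * d) - (a * c) * pderiv (b * d)) ((b * d)\<^sup>2)
     = Fract (pderiv a * b - a * pderiv b) (b\<^sup>2) * g + f * Fract (pderiv c * d - c * pderiv d) (d\<^sup>2)"
    using * by (simp add: eq_fract pderiv_mult power2_eq_square algebra_simps)
  then have "zz * Fract (pderiv (a * c) * (b * d) - (a * c) * pderiv (b * d)) ((b * d)\<^sup>2)
     = zz * (Fract (pderiv a * b - a * pderiv b) (b\<^sup>2) * g + f * Fract (pderiv c * d - c * pderiv d) (d\<^sup>2))"
    by (rule arg_cong)
  also have "\<dots> = rf_deriv f * g + f * rf_deriv g"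
    by (simp only: * rf_deriv_Fract[OF *(2)] rf_deriv_Fract[OF *(4)] distrib_left mult.assoc mult.left_commute)
  finally show ?thesis using * by (simp add: rf_deriv_Fract)
qed

lemma rf_deriv_zz [simp]: "rf_deriv zz = zz"
  by (simp add: zz_def rf_deriv_Fract pderiv_pCons one_pCons fract_expand eq_fract power2_eq_square)

lemma rf_deriv_inverse: "f \<noteq> 0 \<Longrightarrow> rf_deriv (inverse f) = - rf_deriv f / f\<^sup>2"
proof -
  assume f: "f \<noteq> 0"
  then have "f * rf_deriv (inverse f) = - rf_deriv f * inverse f"
    using rf_deriv_mult[of f "inverse f"] by (simp add: add_eq_0_iff)
  then have "f * (f * rf_deriv (inverse f)) = - rf_deriv f"
    using f by simp
  then have "f\<^sup>2 * rf_deriv (inverse f) = - rf_deriv f"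
    by (simp add: power2_eq_square mult.assoc)
  with f show ?thesis by (metis nonzero_mult_div_cancel_left power_not_zero)
qed

lemma rf_deriv_inverse_zz [simp]: "rf_deriv (inverse zz) = - inverse zz"
  by (simp only: rf_deriv_inverse[OF zz_nonzero] rf_deriv_zz)
    (simp add: power2_eq_square divide_inverse)

lemma rf_s_const [simp]: "rf_s (rf_const c) = rf_const c"
  unfolding rf_const_def rf_s_poly by (simp add: poly_at_inv_pCons rf_const_def)

lemma rf_s_0 [simp]: "rf_s 0 = 0" and rf_s_1 [simp]: "rf_s 1 = 1"
  using rf_s_const[of 0] rf_s_const[of 1] by simp_all

lemma rf_s_zz [simp]: "rf_s zz = inverse zz"
  unfolding zz_def rf_s_poly by (simp add: poly_at_inv_pCons zz_def)

lemma rf_s_add: "rf_s (f + g) = rf_s f + rf_s g"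
proof (cases f; cases g)
  fix a b c d :: "complex poly"
  assume "f = Fract a b" "b \<noteq> 0" "g = Fract c d" "d \<noteq> 0"
  then show ?thesis
    by (simp add: rf_s_Fract poly_at_inv_add poly_at_inv_mult add_frac_eq)
qed

lemma rf_s_diff: "rf_s (f - g) = rf_s f - rf_s g"
  using rf_s_add[of "f - g" g] by (simp add: algebra_simps)

lemma rf_s_mult: "rf_s (f * g) = rf_s f * rf_s g"
proof (cases f; cases g)
  fix a b c d :: "complex poly"
  assume "f = Fract a b" "b \<noteq> 0" "g = Fract c d" "d \<noteq> 0"
  then show ?thesis
    by (simp add: rf_s_Fract poly_at_inv_mult)
qed

lemma rf_s_inverse: "rf_s (inverse f) = inverse (rf_s f)"
proof (cases "f = 0")
  case False
  then have "rf_s f * rf_s (inverse f) = 1" using rf_s_mult[of f "inverse f"] by simp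
  then show ?thesis by (simp add: inverse_unique)
qed simp

lemma rf_s_s [simp]: "rf_s (rf_s f) = f"
proof -
  have at_zz: "rf_s (poly_at_inv p) = Fract p 1" for p
    by (induction p) (simp_all add: poly_at_inv_pCons rf_s_add rf_s_mult rf_s_inverse
        Fract_pCons fract_collapse)
  obtain p q where "f = Fract p 1 / Fract q 1" by (rule ratfun_cases)
  then show ?thesis
    by (simp only: divide_inverse rf_s_mult rf_s_inverse rf_s_poly at_zz)
qed

lemma rf_s_deriv: "rf_s (rf_deriv f) = - rf_deriv (rf_s f)"
proof -
  obtain p q where pq: "q \<noteq> 0" "Fract q 1 \<noteq> 0" "f = Fract p 1 / Fract q 1"
    by (rule ratfun_cases)
  define P Q where "P = Fract p 1" and "Q = Fract q 1"
  have poly: "rf_s (rf_deriv (Fract p 1)) = - rf_deriv (rf_s (Fract p 1))" for p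
  proof (induction p)
    case (pCons a p)
    from pCons.IH show ?case
      by (simp add: Fract_pCons rf_deriv_add rf_deriv_mult rf_s_add rf_s_mult algebra_simps)
  qed (simp add: fract_collapse)
  have fP: "f * Q = P" and Q: "Q \<noteq> 0" "rf_s Q \<noteq> 0"
    using pq(1)[folded poly_at_inv_eq_0_iff[of q]] nonzero_eq_divide_eq[OF pq(2), of f "Fract p 1"] pq(2,3)
    unfolding P_def Q_def rf_s_poly by blast+
  have "rf_s (rf_deriv P) = - rf_deriv (rf_s P)" by (simp add: P_def poly)
  then have "rf_s (rf_deriv f) * rf_s Q + rf_s f * rf_s (rf_deriv Q)
      = - (rf_deriv (rf_s f) * rf_s Q + rf_s f * rf_deriv (rf_s Q))"
    by (simp add: fP[symmetric] rf_deriv_mult rf_s_add rf_s_mult)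
  then have "(rf_s (rf_deriv f) + rf_deriv (rf_s f)) * rf_s Q = 0"
    by (simp add: Q_def poly algebra_simps)
  then show ?thesis using Q by (simp add: eq_neg_iff_add_eq_0)
qed

text \<open>The algebra \<open>R\<close>; its generators are \<open>(1 - e\<^sup>-\<^sup>\<epsilon>)\<^sup>-\<^sup>1\<close> and \<open>(1 - e\<^sup>-\<^sup>2\<^sup>\<epsilon>)\<^sup>-\<^sup>1\<close>.\<close>

definition gen1 :: ratfun where
  "gen1 = inverse (1 - inverse zz)"

definition gen2 :: ratfun where
  "gen2 = inverse (1 - inverse (zz ^ 2))"

inductive_set coeff_ring :: "ratfun set" where
  const: "rf_const c \<in> coeff_ring"
| gen1: "gen1 \<in> coeff_ring"
| gen2: "gen2 \<in> coeff_ring"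
| add: "f \<in> coeff_ring \<Longrightarrow> g \<in> coeff_ring \<Longrightarrow> f + g \<in> coeff_ring"
| mult: "f \<in> coeff_ring \<Longrightarrow> g \<in> coeff_ring \<Longrightarrow> f * g \<in> coeff_ring"

lemma coeff_ring_0: "0 \<in> coeff_ring" and coeff_ring_1: "1 \<in> coeff_ring"
  using coeff_ring.const[of 0] coeff_ring.const[of 1] by simp_all

lemma coeff_ring_uminus: "f \<in> coeff_ring \<Longrightarrow> - f \<in> coeff_ring"
proof -
  have "rf_const (- 1) = - 1" by (simp add: rf_const_def fract_expand one_pCons)
  then show "f \<in> coeff_ring \<Longrightarrow> - f \<in> coeff_ring"
    using coeff_ring.mult[OF coeff_ring.const[of "-1"], of f] by simp
qed

lemma coeff_ring_diff: "f \<in> coeff_ring \<Longrightarrow> g \<in> coeff_ring \<Longrightarrow> f - g \<in> coeff_ring"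
  using coeff_ring.add[of f "- g"] coeff_ring_uminus by simp

lemma zz_pow_neq_1: "n > 0 \<Longrightarrow> zz ^ n \<noteq> 1"
proof
  assume n: "n > 0" and "zz ^ n = 1"
  moreover have "zz ^ m = Fract (monom 1 m) 1" for m
    by (induction m) (simp_all add: zz_def monom_Suc fract_collapse)
  ultimately have "monom (1::complex) n = 1" by (simp add: fract_expand eq_fract)
  then have "degree (monom (1::complex) n) = 0" by simp
  with n show False by (simp add: degree_monom_eq)
qed

lemma zz_neq_1: "zz \<noteq> 1" "zz\<^sup>2 \<noteq> 1" "zz * zz \<noteq> 1"
  using zz_pow_neq_1[of 1] zz_pow_neq_1[of 2] by (simp_all add: power2_eq_square)

lemma rf_s_gen1: "rf_s gen1 = 1 - gen1" and rf_s_gen2: "rf_s gen2 = 1 - gen2"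
proof -
  have "rf_s gen1 = inverse (1 - zz)" "rf_s gen2 = inverse (1 - zz * zz)"
    by (simp_all add: gen1_def gen2_def rf_s_diff rf_s_inverse rf_s_mult power2_eq_square)
  then show "rf_s gen1 = 1 - gen1" "rf_s gen2 = 1 - gen2"
    using zz_neq_1 by (simp_all add: gen1_def gen2_def power2_eq_square field_simps)
qed

lemma rf_deriv_gen1: "rf_deriv gen1 = gen1 - gen1\<^sup>2"
  and rf_deriv_gen2: "rf_deriv gen2 = 2 * (gen2 - gen2\<^sup>2)"
proof -
  have diff: "rf_deriv (f - g) = rf_deriv f - rf_deriv g" for f g
    using rf_deriv_add[of "f - g" g] by (simp add: algebra_simps)
  have nz: "1 - inverse zz \<noteq> 0" "1 - inverse (zz\<^sup>2) \<noteq> 0"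
    using zz_neq_1 by (simp_all add: field_simps power2_eq_square)
  have d: "rf_deriv (1 - inverse zz) = inverse zz"
    "rf_deriv (1 - inverse (zz\<^sup>2)) = 2 * inverse (zz\<^sup>2)"
    by (simp_all add: diff rf_deriv_mult power2_eq_square)
  show "rf_deriv gen1 = gen1 - gen1\<^sup>2" "rf_deriv gen2 = 2 * (gen2 - gen2\<^sup>2)"
    unfolding gen1_def gen2_def rf_deriv_inverse[OF nz(1)] rf_deriv_inverse[OF nz(2)] d
    using zz_neq_1 by (simp_all add: power2_eq_square divide_simps) (simp_all add: algebra_simps)
qed

lemma rf_s_coeff_ring: "f \<in> coeff_ring \<Longrightarrow> rf_s f \<in> coeff_ring"
proof (induction rule: coeff_ring.induct)
  case gen1
  show ?case unfolding rf_s_gen1 by (intro coeff_ring_diff coeff_ring_1 coeff_ring.gen1)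
next
  case gen2
  show ?case unfolding rf_s_gen2 by (intro coeff_ring_diff coeff_ring_1 coeff_ring.gen2)
qed (simp_all add: rf_s_add rf_s_mult coeff_ring.const coeff_ring.add coeff_ring.mult)

lemma rf_deriv_coeff_ring: "f \<in> coeff_ring \<Longrightarrow> rf_deriv f \<in> coeff_ring"
proof (induction rule: coeff_ring.induct)
  case gen1
  show ?case unfolding rf_deriv_gen1 power2_eq_square
    by (intro coeff_ring_diff coeff_ring.mult coeff_ring.gen1)
next
  case gen2
  show ?case unfolding rf_deriv_gen2 power2_eq_square mult_2
    by (intro coeff_ring_diff coeff_ring.add coeff_ring.mult coeff_ring.gen2)
qed (simp_all add: rf_deriv_add rf_deriv_mult coeff_ring_0 coeff_ring.add coeff_ring.mult)

section \<open>Differential operators\<close>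

text \<open>
  A polynomial \<open>\<Sum>\<^sub>j f\<^sub>j X\<^sup>j\<close> over the rational functions stands for the differential operator
  \<open>\<Sum>\<^sub>j f\<^sub>j \<partial>\<^sup>j\<close>, where \<open>\<partial> = z d/dz\<close> and the coefficients are written on the left. Left
  multiplication by \<open>\<partial>\<close> is determined by \<open>\<partial> f = f \<partial> + \<partial>(f)\<close>.
\<close>

definition op_shift :: "ratfun poly \<Rightarrow> ratfun poly" where
  "op_shift q = pCons 0 q + map_poly rf_deriv q"

definition op_mult :: "ratfun poly \<Rightarrow> ratfun poly \<Rightarrow> ratfun poly" where
  "op_mult p q = (\<Sum>i\<le>degree p. Polynomial.smult (coeff p i) ((op_shift ^^ i) q))"

text \<open>\<open>s(f \<otimes> p(\<partial>)) = s(f) \<otimes> p(- \<partial>)\<close>\<close>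

definition op_s :: "ratfun poly \<Rightarrow> ratfun poly" where
  "op_s p = pcompose (map_poly rf_s p) [:0, -1:]"

lemma map_poly_rf_deriv_add: "map_poly rf_deriv (p + q) = map_poly rf_deriv p + map_poly rf_deriv q"
  by (rule poly_eqI) (simp add: coeff_map_poly rf_deriv_add)

lemma op_shift_0 [simp]: "op_shift 0 = 0"
  by (simp add: op_shift_def)

lemma op_shift_add: "op_shift (p + q) = op_shift p + op_shift q"
  by (simp add: op_shift_def map_poly_rf_deriv_add)

lemma op_shift_smult:
  "op_shift (Polynomial.smult f p) = Polynomial.smult (rf_deriv f) p + Polynomial.smult f (op_shift p)"
  by (rule poly_eqI) (simp add: op_shift_def coeff_map_poly rf_deriv_mult coeff_pCons algebra_simps
      split: nat.split)

lemma op_shift_pCons: "op_shift (pCons f p) = pCons (rf_deriv f) ([:f:] + op_shift p)"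
  by (simp add: op_shift_def map_poly_pCons)

lemma op_shift_uminus: "op_shift (- p) = - op_shift p"
  using op_shift_add[of p "- p"] by (simp add: add_eq_0_iff)

lemma op_shift_pow_0 [simp]: "(op_shift ^^ i) 0 = 0"
  by (induction i) simp_all

lemma op_shift_pow_add: "(op_shift ^^ i) (p + q) = (op_shift ^^ i) p + (op_shift ^^ i) q"
  by (induction i) (simp_all add: op_shift_add)

lemma op_mult_le:
  "degree p \<le> n \<Longrightarrow> op_mult p q = (\<Sum>i\<le>n. Polynomial.smult (coeff p i) ((op_shift ^^ i) q))"
  unfolding op_mult_def by (rule sum.mono_neutral_left) (auto intro: coeff_eq_0)

lemma op_mult_0_left [simp]: "op_mult 0 q = 0"
  by (simp add: op_mult_def)

lemma op_mult_pCons_left: "op_mult (pCons f p) q = Polynomial.smult f q + op_mult p (op_shift q)"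
proof -
  have "op_mult (pCons f p) q =
      (\<Sum>i\<le>Suc (degree p). Polynomial.smult (coeff (pCons f p) i) ((op_shift ^^ i) q))"
    by (rule op_mult_le) (simp add: degree_pCons_le)
  then show ?thesis
    by (simp add: sum.atMost_Suc_shift op_mult_def funpow_swap1 del: sum.atMost_Suc funpow.simps)
       (simp add: funpow_Suc_right del: funpow.simps)
qed

lemma op_mult_add_left: "op_mult (p + p') q = op_mult p q + op_mult p' q"
  by (induction p p' arbitrary: q rule: poly_induct2)
    (simp_all add: op_mult_pCons_left smult_add_left)

lemma op_mult_add_right: "op_mult p (q + q') = op_mult p q + op_mult p q'"
  by (induction p arbitrary: q q')
    (simp_all add: op_mult_pCons_left smult_add_right op_shift_add)

lemma op_mult_uminus_right: "op_mult p (- q) = - op_mult p q"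
  by (induction p arbitrary: q) (simp_all add: op_mult_pCons_left op_shift_uminus)

lemma op_mult_uminus_left: "op_mult (- p) q = - op_mult p q"
  using op_mult_add_left[of p "- p" q] by (simp add: add_eq_0_iff)

lemma op_mult_smult_left: "op_mult (Polynomial.smult f p) q = Polynomial.smult f (op_mult p q)"
  by (induction p arbitrary: q) (simp_all add: op_mult_pCons_left smult_add_right)

lemma op_mult_shift_left: "op_mult (op_shift p) q = op_shift (op_mult p q)"
  by (induction p arbitrary: q)
    (simp_all add: op_shift_pCons op_mult_pCons_left op_mult_add_left op_shift_add op_shift_smult)

lemma op_mult_assoc: "op_mult (op_mult p q) r = op_mult p (op_mult q r)"
  by (induction p arbitrary: q)
    (simp_all add: op_mult_pCons_left op_mult_add_left op_mult_smult_left op_mult_shift_left)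

lemma op_mult_1_left: "op_mult 1 q = q"
  by (simp add: one_pCons op_mult_pCons_left)

lemma op_mult_1_right: "op_mult p 1 = p"
proof -
  have "(op_shift ^^ i) 1 = monom 1 i" for i
    by (induction i) (simp_all add: op_shift_def map_poly_monom monom_Suc)
  then show ?thesis
    by (simp add: op_mult_def smult_monom poly_as_sum_of_monoms)
qed

lemma op_s_0 [simp]: "op_s 0 = 0"
  by (simp add: op_s_def)

lemma op_s_pCons: "op_s (pCons f p) = [:rf_s f:] - pCons 0 (op_s p)"
  by (simp add: op_s_def map_poly_pCons pcompose_pCons)

lemma op_s_add: "op_s (p + q) = op_s p + op_s q"
  by (induction p q rule: poly_induct2) (simp_all add: op_s_pCons rf_s_add)

lemma op_s_uminus: "op_s (- p) = - op_s p"
  using op_s_add[of p "- p"] by (simp add: add_eq_0_iff)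

lemma op_s_diff: "op_s (p - q) = op_s p - op_s q"
  using op_s_add[of "p - q" q] by (simp add: algebra_simps)

lemma op_s_smult: "op_s (Polynomial.smult f p) = Polynomial.smult (rf_s f) (op_s p)"
  by (induction p) (simp_all add: op_s_pCons rf_s_mult)

lemma op_s_shift: "op_s (op_shift p) = - op_shift (op_s p)"
proof (induction p)
  case (pCons f p)
  have "op_shift (x - y) = op_shift x - op_shift y" for x y
    using op_shift_add[of "x - y" y] by (simp add: algebra_simps)
  with pCons show ?case
    by (simp add: op_shift_pCons op_s_pCons op_s_add rf_s_deriv op_shift_uminus)
qed simp

lemma op_s_mult: "op_s (op_mult p q) = op_mult (op_s p) (op_s q)"
proof (induction p arbitrary: q)
  case (pCons f p)
  have "op_mult (x - y) r = op_mult x r - op_mult y r" for x y r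
    using op_mult_add_left[of "x - y" y r] by (simp add: algebra_simps)
  with pCons show ?case
    by (simp add: op_mult_pCons_left op_s_pCons op_s_add op_s_smult op_s_shift
        op_mult_uminus_left op_mult_uminus_right)
qed simp

typedef diff_op = "UNIV :: ratfun poly set"
  morphisms op_coeffs diff_op ..

setup_lifting type_definition_diff_op

instantiation diff_op :: ring_1
begin

lift_definition zero_diff_op :: diff_op is 0 .
lift_definition one_diff_op :: diff_op is 1 .
lift_definition plus_diff_op :: "diff_op \<Rightarrow> diff_op \<Rightarrow> diff_op" is "(+)" .
lift_definition minus_diff_op :: "diff_op \<Rightarrow> diff_op \<Rightarrow> diff_op" is "(-)" .
lift_definition uminus_diff_op :: "diff_op \<Rightarrow> diff_op" is uminus .
lift_definition times_diff_op :: "diff_op \<Rightarrow> diff_op \<Rightarrow> diff_op" is op_mult .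

instance
  by standard (transfer; simp add: op_mult_assoc op_mult_1_left op_mult_1_right op_mult_add_left
      op_mult_add_right)+

end

definition fun_op :: "ratfun \<Rightarrow> diff_op" where
  "fun_op f = diff_op [:f:]"

definition partial_xi :: diff_op where
  "partial_xi = diff_op [:0, 1:]"

definition dop_s :: "diff_op \<Rightarrow> diff_op" where
  "dop_s D = diff_op (op_s (op_coeffs D))"

lemma op_coeffs_simps [simp]:
  "op_coeffs 0 = 0" "op_coeffs 1 = 1" "op_coeffs (D + E) = op_coeffs D + op_coeffs E"
  "op_coeffs (D - E) = op_coeffs D - op_coeffs E" "op_coeffs (- D) = - op_coeffs D"
  "op_coeffs (D * E) = op_mult (op_coeffs D) (op_coeffs E)"
  "op_coeffs (fun_op f) = [:f:]" "op_coeffs partial_xi = [:0, 1:]"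
  "op_coeffs (dop_s D) = op_s (op_coeffs D)"
  by (simp_all add: zero_diff_op.rep_eq one_diff_op.rep_eq plus_diff_op.rep_eq minus_diff_op.rep_eq
      uminus_diff_op.rep_eq times_diff_op.rep_eq fun_op_def partial_xi_def dop_s_def diff_op_inverse)

lemma partial_xi_fun_op:
  "partial_xi * fun_op f = fun_op f * partial_xi + fun_op (rf_deriv f)"
  by (simp add: op_coeffs_inject[symmetric] op_mult_pCons_left op_shift_pCons)

lemma dop_s_add: "dop_s (D + E) = dop_s D + dop_s E"
  and dop_s_mult: "dop_s (D * E) = dop_s D * dop_s E"
  and dop_s_fun_op [simp]: "dop_s (fun_op f) = fun_op (rf_s f)"
  and dop_s_partial_xi [simp]: "dop_s partial_xi = - partial_xi"
  and dop_s_0 [simp]: "dop_s 0 = 0"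
  and dop_s_1 [simp]: "dop_s 1 = 1"
  and dop_s_uminus: "dop_s (- D) = - dop_s D"
  and dop_s_diff: "dop_s (D - E) = dop_s D - dop_s E"
  by (simp_all add: op_coeffs_inject[symmetric] op_s_add op_s_mult op_s_pCons op_s_uminus op_s_diff one_pCons)

lemma fun_op_1 [simp]: "fun_op 1 = 1" and fun_op_0 [simp]: "fun_op 0 = 0"
  and fun_op_add: "fun_op (f + g) = fun_op f + fun_op g"
  and fun_op_uminus: "fun_op (- f) = - fun_op f"
  and fun_op_mult: "fun_op (f * g) = fun_op f * fun_op g"
  by (simp_all add: op_coeffs_inject[symmetric] one_pCons op_mult_pCons_left)

lemma op_mult_const_right:
  "op_mult p [:rf_const c:] = Polynomial.smult (rf_const c) p"
proof -
  have "op_mult p (Polynomial.smult (rf_const c) q) = Polynomial.smult (rf_const c) (op_mult p q)" for q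
    by (induction p arbitrary: q)
      (simp_all add: op_mult_pCons_left op_shift_smult smult_add_right mult.commute)
  from this[of 1] show ?thesis by (simp add: op_mult_1_right smult_one)
qed

lemma fun_op_const_commute: "fun_op (rf_const c) * D = D * fun_op (rf_const c)"
  by (simp add: op_coeffs_inject[symmetric] op_mult_pCons_left op_mult_const_right)

text \<open>All differential operators with rational coefficients; \<open>D\<^sub>R = R \<otimes> \<complex>[\<partial>]\<close> is the subalgebra
  of those with all coefficients in \<open>R\<close>.\<close>

definition DK_alg :: "(complex, diff_op) module" where
  "DK_alg = \<lparr>carrier = UNIV, mult = (*), one = 1, zero = 0, add = (+),
     smult = (\<lambda>c D. fun_op (rf_const c) * D)\<rparr>"

definition DR_alg :: "(complex, diff_op) module" where
  "DR_alg = DK_alg\<lparr>carrier := {D. \<forall>j. coeff (op_coeffs D) j \<in> coeff_ring}\<rparr>"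

lemma complex_algebraI:
  fixes m :: "'a::ring_1 \<Rightarrow> 'a \<Rightarrow> 'a"
  assumes "\<And>x y z. m (m x y) z = m x (m y z)" "\<And>x. m u x = x" "\<And>x. m x u = x"
    "\<And>x y z. m (x + y) z = m x z + m y z" "\<And>x y z. m x (y + z) = m x y + m x z"
    "\<And>c d x. sc (c + d) x = sc c x + sc d x" "\<And>c x y. sc c (x + y) = sc c x + sc c y"
    "\<And>c d x. sc (c * d) x = sc c (sc d x)" "\<And>x. sc 1 x = x"
    "\<And>c x y. m (sc c x) y = sc c (m x y)" "\<And>c x y. m x (sc c y) = sc c (m x y)"
  shows "complex_algebra \<lparr>carrier = UNIV, mult = m, one = u, zero = 0, add = (+), smult = sc\<rparr>"
proof -
  have neg: "\<exists>y. y + x = 0" "\<exists>y. x + y = 0" for x :: 'a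
    by (rule exI[of _ "- x"], simp)+
  have "ring \<lparr>carrier = UNIV, mult = m, one = u, zero = 0, add = (+), smult = sc\<rparr>"
    by (rule ringI; (rule abelian_groupI monoid.intro)?) (auto simp: assms neg add_ac)
  then show ?thesis
    by (rule complex_algebra.intro, unfold_locales) (simp_all add: assms)
qed

lemma complex_algebra_DK: "complex_algebra DK_alg"
  unfolding DK_alg_def
proof (rule complex_algebraI)
  fix c :: complex and x y :: diff_op
  show "x * (fun_op (rf_const c) * y) = fun_op (rf_const c) * (x * y)"
    by (metis fun_op_const_commute mult.assoc)
qed (simp_all add: mult.assoc distrib_left distrib_right rf_const_add rf_const_mult fun_op_add
    fun_op_mult)

lemma coeff_ring_sum: "(\<And>i. i \<in> I \<Longrightarrow> f i \<in> coeff_ring) \<Longrightarrow> sum f I \<in> coeff_ring"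
  by (induction I rule: infinite_finite_induct) (auto intro: coeff_ring.add coeff_ring_0)

lemma op_shift_coeff_ring:
  "(\<And>j. coeff p j \<in> coeff_ring) \<Longrightarrow> coeff (op_shift p) j \<in> coeff_ring"
  by (auto simp: op_shift_def coeff_map_poly coeff_pCons coeff_ring_0 split: nat.split
      intro!: coeff_ring.add rf_deriv_coeff_ring)

lemma op_mult_coeff_ring:
  assumes "\<And>j. coeff p j \<in> coeff_ring" "\<And>j. coeff q j \<in> coeff_ring"
  shows "coeff (op_mult p q) j \<in> coeff_ring"
proof -
  have "\<forall>j. coeff ((op_shift ^^ i) q) j \<in> coeff_ring" for i
    by (induction i) (auto simp: assms(2) intro: op_shift_coeff_ring)
  then show ?thesis
    by (auto simp: op_mult_def coeff_sum intro!: coeff_ring_sum coeff_ring.mult assms(1))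
qed

lemma fun_op_in_DR: "f \<in> coeff_ring \<Longrightarrow> fun_op f \<in> carrier DR_alg"
  by (auto simp: DR_alg_def coeff_pCons coeff_ring_0 split: nat.split)

lemma partial_xi_in_DR: "partial_xi \<in> carrier DR_alg"
  by (auto simp: DR_alg_def coeff_pCons coeff_ring_0 coeff_ring_1 split: nat.split)

lemma DR_closed:
  "0 \<in> carrier DR_alg" "1 \<in> carrier DR_alg"
  "D \<in> carrier DR_alg \<Longrightarrow> E \<in> carrier DR_alg \<Longrightarrow> D + E \<in> carrier DR_alg"
  "D \<in> carrier DR_alg \<Longrightarrow> E \<in> carrier DR_alg \<Longrightarrow> D - E \<in> carrier DR_alg"
  "D \<in> carrier DR_alg \<Longrightarrow> - D \<in> carrier DR_alg"
  "D \<in> carrier DR_alg \<Longrightarrow> E \<in> carrier DR_alg \<Longrightarrow> D * E \<in> carrier DR_alg"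
  using fun_op_in_DR[OF coeff_ring_0] fun_op_in_DR[OF coeff_ring_1]
  by (simp_all add: DR_alg_def coeff_ring.add coeff_ring_diff coeff_ring_uminus op_mult_coeff_ring)

lemma complex_algebra_DR: "complex_algebra DR_alg"
  unfolding DR_alg_def
proof (rule complex_algebra_subalgebra[OF complex_algebra_DK], goal_cases)
  case (5 c D)
  then show ?case
    using DR_closed(6)[OF fun_op_in_DR[OF coeff_ring.const]] by (simp add: DK_alg_def DR_alg_def)
qed (use DR_closed in \<open>simp_all add: DK_alg_def DR_alg_def\<close>)

lemma dop_s_in_DR: "D \<in> carrier DR_alg \<Longrightarrow> dop_s D \<in> carrier DR_alg"
proof -
  have "(\<And>j. coeff p j \<in> coeff_ring) \<Longrightarrow> coeff (op_s p) j \<in> coeff_ring" for p j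
  proof (induction p arbitrary: j)
    case (pCons f p)
    have "f \<in> coeff_ring" "\<And>j. coeff p j \<in> coeff_ring"
      using pCons.prems[of 0] pCons.prems[of "Suc _"] by simp_all
    with pCons.IH show ?case
      by (auto simp: op_s_pCons coeff_pCons coeff_ring_0 rf_s_coeff_ring coeff_ring_uminus
          split: nat.split)
  qed (simp add: coeff_ring_0)
  then show "D \<in> carrier DR_alg \<Longrightarrow> dop_s D \<in> carrier DR_alg"
    by (simp add: DR_alg_def)
qed


section \<open>Matrix differential operators\<close>

text \<open>\<open>D\<^sub>R \<otimes> M\<^sub>2\<close> is rendered as the algebra of matrices with entries in \<open>D\<^sub>R\<close>.\<close>

type_synonym dop_matrix = "diff_op ^ 2 ^ 2"

definition pi_s :: dop_matrix where
  "pi_s = vector [vector [0, 1], vector [1, 0]]"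

text \<open>\<open>s(D \<otimes> A) = s(D) \<otimes> \<pi>(s) A \<pi>(s)\<^sup>-\<^sup>1\<close>\<close>

definition mat_s :: "dop_matrix \<Rightarrow> dop_matrix" where
  "mat_s X = pi_s ** map_matrix dop_s X ** matrix_inv pi_s"

definition MDR_alg :: "(complex, dop_matrix) module" where
  "MDR_alg = \<lparr>carrier = {X. \<forall>i j. X $ i $ j \<in> carrier DR_alg}, mult = (**), one = mat 1, zero = 0,
     add = (+), smult = (\<lambda>c. map_matrix (\<lambda>D. c \<odot>\<^bsub>DR_alg\<^esub> D))\<rparr>"

definition MDR_inv_alg :: "(complex, dop_matrix) module" where
  "MDR_inv_alg = MDR_alg\<lparr>carrier := {X \<in> carrier MDR_alg. mat_s X = X}\<rparr>"

definition rho :: "complex \<times> complex \<Rightarrow> complex" where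
  "rho k = (fst k + 2 * snd k) / 2"

text \<open>With \<open>a = k\<^sub>1/(1 - e\<^sup>-\<^sup>\<epsilon>) + 2 k\<^sub>2/(1 - e\<^sup>-\<^sup>2\<^sup>\<epsilon>)\<close> and \<open>b\<close> the same with \<open>e\<^sup>\<epsilon>\<close>, \<open>e\<^sup>2\<^sup>\<epsilon>\<close>.\<close>

definition D_tilde :: "complex \<times> complex \<Rightarrow> dop_matrix" where
  "D_tilde k = (let
       k1 = rf_const (fst k); k2 = rf_const (snd k);
       a = k1 / (1 - inverse zz) + 2 * k2 / (1 - inverse (zz ^ 2));
       b = k1 / (1 - zz) + 2 * k2 / (1 - zz ^ 2);
       r = rf_const (rho k)
     in vector [vector [partial_xi + fun_op (a - r), - fun_op a],
                vector [- fun_op b, - partial_xi - fun_op (a - r)]])"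

definition Dns_alg :: "complex \<times> complex \<Rightarrow> (complex, dop_matrix) module" where
  "Dns_alg k = MDR_inv_alg\<lparr>carrier := {X \<in> carrier MDR_inv_alg. X ** D_tilde k = D_tilde k ** X}\<rparr>"

lemma pi_s_square: "pi_s ** pi_s = mat 1"
  by (simp add: pi_s_def matrix_matrix_mult_def mat_def vec_eq_iff forall_2 sum_2)

lemma matrix_inv_pi_s: "matrix_inv pi_s = pi_s"
proof -
  have "pi_s ** matrix_inv pi_s = mat 1 \<and> matrix_inv pi_s ** pi_s = mat 1"
    unfolding matrix_inv_def by (rule someI[of _ pi_s]) (simp add: pi_s_square)
  then show ?thesis
    by (metis matrix_mul_assoc matrix_mul_lid matrix_mul_rid pi_s_square)
qed

lemma mat_s_entries:
  "mat_s X $ 1 $ 1 = dop_s (X $ 2 $ 2)" "mat_s X $ 1 $ 2 = dop_s (X $ 2 $ 1)"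
  "mat_s X $ 2 $ 1 = dop_s (X $ 1 $ 2)" "mat_s X $ 2 $ 2 = dop_s (X $ 1 $ 1)"
  unfolding mat_s_def matrix_inv_pi_s
  by (simp_all add: pi_s_def matrix_matrix_mult_def sum_2)

lemma mat2_eq_iff:
  "(X :: 'a ^ 2 ^ 2) = Y \<longleftrightarrow> X $ 1 $ 1 = Y $ 1 $ 1 \<and> X $ 1 $ 2 = Y $ 1 $ 2 \<and>
     X $ 2 $ 1 = Y $ 2 $ 1 \<and> X $ 2 $ 2 = Y $ 2 $ 2"
  by (auto simp: vec_eq_iff forall_2)

lemma mat_s_add: "mat_s (X + Y) = mat_s X + mat_s Y"
  and mat_s_mult: "mat_s (X ** Y) = mat_s X ** mat_s Y"
  and mat_s_1: "mat_s (mat 1) = mat 1"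
  by (simp_all add: mat2_eq_iff mat_s_entries dop_s_add dop_s_mult matrix_matrix_mult_def sum_2
      mat_def add.commute)

lemma mat2_add_rdistrib: "((A :: dop_matrix) + B) ** (C :: dop_matrix) = A ** C + B ** C"
  by (simp add: matrix_matrix_mult_def vec_eq_iff sum_2 distrib_right add_ac)

lemma complex_algebra_MDR: "complex_algebra MDR_alg"
proof -
  let ?M = "\<lparr>carrier = UNIV :: dop_matrix set, mult = (**), one = mat 1, zero = 0,
     add = (+), smult = (\<lambda>c. map_matrix (\<lambda>D. c \<odot>\<^bsub>DR_alg\<^esub> D))\<rparr>"
  have M: "complex_algebra ?M"
  proof (rule complex_algebraI)
    fix c :: complex and x y :: dop_matrix
    show "x ** map_matrix (\<lambda>D. c \<odot>\<^bsub>DR_alg\<^esub> D) y = map_matrix (\<lambda>D. c \<odot>\<^bsub>DR_alg\<^esub> D) (x ** y)"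
      by (simp add: vec_eq_iff matrix_matrix_mult_def DR_alg_def DK_alg_def sum_distrib_left
          sum_distrib_right mult.assoc[symmetric] fun_op_const_commute)
  qed (simp_all add: matrix_mul_assoc matrix_add_ldistrib mat2_add_rdistrib,
      simp_all add: vec_eq_iff matrix_matrix_mult_def DR_alg_def DK_alg_def sum_distrib_left
        mult.assoc distrib_left distrib_right rf_const_add rf_const_mult fun_op_add fun_op_mult)
  have "complex_algebra (?M\<lparr>carrier := {X. \<forall>i j. X $ i $ j \<in> carrier DR_alg}\<rparr>)"
    using DR_closed complex_algebra.smult_closed[OF complex_algebra_DR]
    by (intro complex_algebra_subalgebra[OF M])
      (auto simp: matrix_matrix_mult_def sum_2 mat_def)
  then show ?thesis by (simp add: MDR_alg_def)
qed

lemma complex_algebra_MDR_inv: "complex_algebra MDR_inv_alg"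
proof -
  interpret complex_algebra MDR_alg by (rule complex_algebra_MDR)
  show ?thesis
    unfolding MDR_inv_alg_def
  proof (rule complex_algebra_subalgebra[OF complex_algebra_MDR], goal_cases)
    case (5 c X)
    then show ?case
      using smult_closed[of X c]
      by (auto simp: MDR_alg_def mat2_eq_iff mat_s_entries DR_alg_def DK_alg_def dop_s_mult)
  qed (use one_closed add.m_closed m_closed in
      \<open>auto simp: MDR_alg_def mat_s_add mat_s_mult mat_s_1\<close>)
qed

lemma D_tilde_in_MDR_inv: "D_tilde k \<in> carrier MDR_inv_alg"
proof -
  define k1 k2 r where k: "k1 = rf_const (fst k)" "k2 = rf_const (snd k)" "r = rf_const (rho k)"
  define a b where "a = k1 * gen1 + 2 * (k2 * gen2)" and "b = k1 * (1 - gen1) + 2 * (k2 * (1 - gen2))"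
  have gens: "inverse (1 - zz) = 1 - gen1" "inverse (1 - zz ^ 2) = 1 - gen2"
    using zz_neq_1 by (simp_all add: gen1_def gen2_def power2_eq_square field_simps)
  have eq: "D_tilde k = vector [vector [partial_xi + fun_op (a - r), - fun_op a],
      vector [- fun_op b, - partial_xi - fun_op (a - r)]]"
    unfolding D_tilde_def Let_def divide_inverse gens gen1_def[symmetric] gen2_def[symmetric] k[symmetric]
    by (simp only: a_def b_def mult.assoc)
  have k_in: "k1 \<in> coeff_ring" "k2 \<in> coeff_ring" "r \<in> coeff_ring"
    by (simp_all add: k coeff_ring.const)
  have ab: "a \<in> coeff_ring" "b \<in> coeff_ring" "a - r \<in> coeff_ring"
    unfolding a_def b_def mult_2
    by (intro coeff_ring_diff coeff_ring.add coeff_ring.mult coeff_ring.gen1 coeff_ring.gen2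
        coeff_ring_1 k_in)+
  have ks: "rf_s k1 = k1" "rf_s k2 = k2" "rf_s r = r"
    by (simp_all add: k)
  have s: "rf_s a = b" "rf_s b = a"
    unfolding a_def b_def mult_2
    by (simp_all only: rf_s_add rf_s_mult rf_s_diff rf_s_1 rf_s_gen1 rf_s_gen2 ks) simp
  have "r + r = k1 + (k2 + k2)"
    by (simp add: k rf_const_add[symmetric] rho_def)
  moreover have "a + b = k1 + (k2 + k2)"
    unfolding a_def b_def mult_2 by (simp only: right_diff_distrib) simp
  ultimately have "b - r = - (a - r)"
    by (simp add: algebra_simps eq_neg_iff_add_eq_0)
  then have sr: "rf_s (a - r) = - (a - r)"
    by (simp add: rf_s_diff s ks)
  define e where "e = a - r"
  have e: "rf_s e = - e" "e \<in> coeff_ring"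
    using sr ab(3) by (simp_all only: e_def)
  have "\<forall>i j. D_tilde k $ i $ j \<in> carrier DR_alg"
    unfolding eq e_def[symmetric] using ab e(2)
    by (simp add: forall_2 DR_closed partial_xi_in_DR fun_op_in_DR)
  moreover have "mat_s (D_tilde k) = D_tilde k"
    unfolding mat2_eq_iff mat_s_entries eq e_def[symmetric]
    by (simp add: dop_s_add dop_s_diff dop_s_uminus s e(1) fun_op_uminus)
  ultimately show ?thesis by (simp add: MDR_inv_alg_def MDR_alg_def)
qed

lemma complex_algebra_Dns: "complex_algebra (Dns_alg k)"
proof -
  interpret complex_algebra MDR_inv_alg by (rule complex_algebra_MDR_inv)
  have 1: "\<And>x y. x \<otimes>\<^bsub>MDR_inv_alg\<^esub> y = x ** y" "\<And>x y. x \<oplus>\<^bsub>MDR_inv_alg\<^esub> y = x + y"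
    "\<one>\<^bsub>MDR_inv_alg\<^esub> = mat 1"
    by (simp_all add: MDR_inv_alg_def MDR_alg_def)
  note D = D_tilde_in_MDR_inv[of k]
  show ?thesis
    unfolding Dns_alg_def
  proof (rule complex_algebra_subalgebra[OF complex_algebra_MDR_inv], goal_cases)
    case (5 c X)
    then show ?case
      using smult_mult_left[OF _ D, of X c] smult_mult_right[OF D, of X c] smult_closed[of X c]
      by (simp add: 1)
  next
    case (4 X Y)
    then show ?case
      using m_closed[of X Y] by (simp add: 1) (metis matrix_mul_assoc)
  qed (use one_closed add.m_closed in \<open>auto simp: 1 matrix_add_ldistrib mat2_add_rdistrib\<close>)
qed


section \<open>The Harish-Chandra homomorphism\<close>

text \<open>\<open>S(h) = \<complex>[\<xi>]\<close> is the type \<open>complex poly\<close>, with \<open>\<xi> = [:0, 1:]\<close>.\<close>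

definition Sh_alg :: "(complex, complex poly) module" where
  "Sh_alg = \<lparr>carrier = UNIV, mult = (*), one = 1, zero = 0, add = (+), smult = Polynomial.smult\<rparr>"

definition sh_s :: "complex poly \<Rightarrow> complex poly" where
  "sh_s p = pcompose p [:0, -1:]"

text \<open>The product of the type \<open>complex poly ^ 2\<close> is componentwise.\<close>

definition Sh2_alg :: "(complex, complex poly ^ 2) module" where
  "Sh2_alg = \<lparr>carrier = UNIV, mult = (*), one = 1, zero = 0, add = (+),
     smult = (\<lambda>c P. \<chi> i. Polynomial.smult c (P $ i))\<rparr>"

definition sh2_s :: "complex poly ^ 2 \<Rightarrow> complex poly ^ 2" where
  "sh2_s P = vector [sh_s (P $ 2), sh_s (P $ 1)]"

definition Sh2_inv_alg :: "(complex, complex poly ^ 2) module" where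
  "Sh2_inv_alg = Sh2_alg\<lparr>carrier := {P \<in> carrier Sh2_alg. sh2_s P = P}\<rparr>"

text \<open>The unique algebra homomorphism with the prescribed values on the generators of \<open>D\<^sub>R\<close>
  (existence and uniqueness are \<open>gamma_ex1\<close> below); \<open>extensional\<close> only fixes the irrelevant
  values outside \<open>D\<^sub>R\<close>.\<close>

definition gamma :: "complex \<times> complex \<Rightarrow> diff_op \<Rightarrow> complex poly" where
  "gamma k = (THE g. g \<in> calg_hom DR_alg Sh_alg \<and> g \<in> extensional (carrier DR_alg) \<and>
     g (fun_op gen1) = 1 \<and> g (fun_op gen2) = 1 \<and> g partial_xi = [:0, 1:] - [:rho k:])"

definition gamma_ns :: "complex \<times> complex \<Rightarrow> dop_matrix \<Rightarrow> complex poly ^ 2 ^ 2" where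
  "gamma_ns k = map_matrix (gamma k)"

definition diag :: "complex poly ^ 2 ^ 2 \<Rightarrow> complex poly ^ 2" where
  "diag P = vector [P $ 1 $ 1, P $ 2 $ 2]"

definition proj1 :: "complex poly ^ 2 \<Rightarrow> complex poly" where
  "proj1 P = P $ 1"

definition gamma_HC :: "complex \<times> complex \<Rightarrow> dop_matrix \<Rightarrow> complex poly" where
  "gamma_HC k = proj1 \<circ> (diag \<circ> gamma_ns k)"

lemma complex_algebra_Sh: "complex_algebra Sh_alg"
  unfolding Sh_alg_def
  by (rule complex_algebraI) (simp_all add: algebra_simps smult_add_left smult_add_right)

lemma complex_algebra_Sh2: "complex_algebra Sh2_alg"
  unfolding Sh2_alg_def
  by (rule complex_algebraI)
    (simp_all add: algebra_simps, simp_all add: vec_eq_iff smult_add_left smult_add_right mult.commute)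

lemma complex_algebra_Sh2_inv: "complex_algebra Sh2_inv_alg"
proof -
  have inv: "sh2_s P = P \<longleftrightarrow> sh_s (P $ 2) = P $ 1 \<and> sh_s (P $ 1) = P $ 2" for P
    by (simp add: sh2_s_def vec_eq_iff forall_2)
  have s: "sh_s 1 = 1" "sh_s (p + q) = sh_s p + sh_s q" "sh_s (p * q) = sh_s p * sh_s q"
    "sh_s (Polynomial.smult c p) = Polynomial.smult c (sh_s p)" for p q c
    by (simp_all add: sh_s_def pcompose_add pcompose_mult pcompose_smult pcompose_1)
  show ?thesis
    unfolding Sh2_inv_alg_def
    by (rule complex_algebra_subalgebra[OF complex_algebra_Sh2])
      (simp_all add: Sh2_alg_def inv s)
qed

lemma coeff_mult_le:
  fixes p q :: "complex poly"
  assumes "degree p \<le> m" "degree q \<le> n"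
  shows "coeff (p * q) (m + n) = coeff p m * coeff q n"
proof -
  have "coeff (p * q) (m + n) = (\<Sum>i\<le>m + n. coeff p i * coeff q (m + n - i))"
    by (rule coeff_mult)
  also have "\<dots> = (\<Sum>i\<in>{m}. coeff p i * coeff q (m + n - i))"
  proof (rule sum.mono_neutral_right)
    show "\<forall>i\<in>{..m + n} - {m}. coeff p i * coeff q (m + n - i) = 0"
    proof
      fix i assume "i \<in> {..m + n} - {m}"
      then have "degree p < i \<or> degree q < m + n - i" using assms by auto
      then show "coeff p i * coeff q (m + n - i) = 0" by (auto simp: coeff_eq_0)
    qed
  qed auto
  finally show ?thesis by simp
qed

text \<open>\<open>at_inf f c\<close>: the rational function \<open>f\<close> has the finite value \<open>c\<close> at \<open>z = \<infinity>\<close>. Evaluating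
  the coefficients there gives the existence of \<open>gamma\<close>.\<close>

definition at_inf :: "ratfun \<Rightarrow> complex \<Rightarrow> bool" where
  "at_inf f c \<longleftrightarrow> (\<exists>p q. q \<noteq> 0 \<and> degree p \<le> degree q \<and> f = Fract p q \<and>
     coeff p (degree q) = c * lead_coeff q)"

lemma at_infI:
  "q \<noteq> 0 \<Longrightarrow> degree p \<le> degree q \<Longrightarrow> f = Fract p q \<Longrightarrow> coeff p (degree q) = c * lead_coeff q \<Longrightarrow> at_inf f c"
  unfolding at_inf_def by blast

lemma at_inf_unique: "at_inf f c \<Longrightarrow> at_inf f d \<Longrightarrow> c = d"
proof -
  assume "at_inf f c" "at_inf f d"
  then obtain p q p' q' where *: "q \<noteq> 0" "degree p \<le> degree q" "f = Fract p q"
      "coeff p (degree q) = c * lead_coeff q" and **: "q' \<noteq> 0" "degree p' \<le> degree q'"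
      "f = Fract p' q'" "coeff p' (degree q') = d * lead_coeff q'"
    unfolding at_inf_def by blast
  have "p * q' = p' * q" using * ** by (simp add: eq_fract)
  then have "coeff p (degree q) * lead_coeff q' = coeff p' (degree q') * lead_coeff q"
    using coeff_mult_le[of p "degree q" q' "degree q'"] coeff_mult_le[of p' "degree q'" q "degree q"] * **
    by (simp add: add.commute)
  then have "(c - d) * (lead_coeff q * lead_coeff q') = 0"
    using * ** by (simp add: algebra_simps)
  then show ?thesis using * ** by simp
qed

lemma at_inf_const: "at_inf (rf_const c) c"
  by (rule at_infI[of 1 "[:c:]"]) (simp_all add: rf_const_def)

lemma at_inf_mult: "at_inf f c \<Longrightarrow> at_inf g d \<Longrightarrow> at_inf (f * g) (c * d)"
proof -
  assume "at_inf f c" "at_inf g d"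
  then obtain p q p' q' where *: "q \<noteq> 0" "degree p \<le> degree q" "f = Fract p q"
      "coeff p (degree q) = c * lead_coeff q" and **: "q' \<noteq> 0" "degree p' \<le> degree q'"
      "g = Fract p' q'" "coeff p' (degree q') = d * lead_coeff q'"
    unfolding at_inf_def by blast
  show ?thesis
  proof (rule at_infI[of "q * q'" "p * p'"])
    show "degree (p * p') \<le> degree (q * q')"
      using * ** degree_mult_le[of p p'] by (simp add: degree_mult_eq)
    show "coeff (p * p') (degree (q * q')) = c * d * lead_coeff (q * q')"
      using * ** coeff_mult_le[of p "degree q" p' "degree q'"]
      by (simp add: degree_mult_eq coeff_mult_degree_sum)
  qed (use * ** in simp_all)
qed

lemma at_inf_add: "at_inf f c \<Longrightarrow> at_inf g d \<Longrightarrow> at_inf (f + g) (c + d)"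
proof -
  assume "at_inf f c" "at_inf g d"
  then obtain p q p' q' where *: "q \<noteq> 0" "degree p \<le> degree q" "f = Fract p q"
      "coeff p (degree q) = c * lead_coeff q" and **: "q' \<noteq> 0" "degree p' \<le> degree q'"
      "g = Fract p' q'" "coeff p' (degree q') = d * lead_coeff q'"
    unfolding at_inf_def by blast
  show ?thesis
  proof (rule at_infI[of "q * q'" "p * q' + p' * q"])
    have "degree (p * q') \<le> degree q + degree q'" "degree (p' * q) \<le> degree q + degree q'"
      using * ** degree_mult_le[of p q'] degree_mult_le[of p' q] by simp_all
    then show "degree (p * q' + p' * q) \<le> degree (q * q')"
      using * ** by (simp add: degree_mult_eq degree_add_le)
    show "coeff (p * q' + p' * q) (degree (q * q')) = (c + d) * lead_coeff (q * q')"
      using * ** coeff_mult_le[of p "degree q" q' "degree q'"] coeff_mult_le[of p' "degree q'" q "degree q"]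
      by (simp add: degree_mult_eq coeff_mult_degree_sum add.commute[of "degree q"] algebra_simps)
  qed (use * ** in simp_all)
qed

lemma at_inf_gen1: "at_inf gen1 1" and at_inf_gen2: "at_inf gen2 1"
proof -
  have eq: "gen1 = Fract [:0, 1:] [:-1, 1:]" "gen2 = Fract [:0, 0, 1:] [:-1, 0, 1:]"
    by (simp_all add: gen1_def gen2_def zz_def fract_expand eq_fract power2_eq_square one_pCons)
  show "at_inf gen1 1"
    by (rule at_infI[OF _ _ eq(1)]) simp_all
  show "at_inf gen2 1"
    by (rule at_infI[OF _ _ eq(2)]) simp_all
qed

lemma at_inf_diff: "at_inf f c \<Longrightarrow> at_inf g d \<Longrightarrow> at_inf (f - g) (c - d)"
proof -
  have "rf_const (- 1) = - 1" by (simp add: rf_const_def fract_expand one_pCons)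
  then show "at_inf f c \<Longrightarrow> at_inf g d \<Longrightarrow> at_inf (f - g) (c - d)"
    using at_inf_add[OF _ at_inf_mult[OF at_inf_const[of "-1"]], of f c g d] by simp
qed

lemma at_inf_coeff_ring: "f \<in> coeff_ring \<Longrightarrow> (\<exists>c. at_inf f c) \<and> at_inf (rf_deriv f) 0"
proof (induction rule: coeff_ring.induct)
  case (const c)
  then show ?case using at_inf_const[of c] at_inf_const[of 0] by auto
next
  case gen1
  then show ?case
    using at_inf_gen1 at_inf_diff[OF at_inf_gen1 at_inf_mult[OF at_inf_gen1 at_inf_gen1]]
    by (auto simp: rf_deriv_gen1 power2_eq_square)
next
  case gen2
  have *: "at_inf (gen2 - gen2\<^sup>2) 0"
    using at_inf_diff[OF at_inf_gen2 at_inf_mult[OF at_inf_gen2 at_inf_gen2]]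
    by (simp add: power2_eq_square)
  show ?case
    unfolding rf_deriv_gen2 mult_2 using at_inf_gen2 at_inf_add[OF * *] by auto
next
  case (add f g)
  then show ?case
    using at_inf_add[of f _ g] at_inf_add[of "rf_deriv f" 0 "rf_deriv g" 0]
    by (auto simp: rf_deriv_add)
next
  case (mult f g)
  then obtain c d where cd: "at_inf f c" "at_inf g d" by blast
  have "at_inf (rf_deriv f * g + f * rf_deriv g) (0 * d + c * 0)"
    using mult cd by (intro at_inf_add at_inf_mult) auto
  with at_inf_mult[OF cd] show ?case by (auto simp: rf_deriv_mult)
qed

lemma op_mult_partial_right: "op_mult p [:0, 1:] = pCons 0 p"
proof -
  have shift: "(op_shift ^^ i) [:0, 1:] = monom 1 (Suc i)" for i
  proof (induction i)
    case (Suc i)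
    have "op_shift (monom 1 j) = monom 1 (Suc j)" for j
      by (simp add: op_shift_def map_poly_monom monom_Suc)
    then show ?case using Suc by simp
  qed (simp add: monom_Suc monom_0)
  have "op_mult p [:0, 1:] = (\<Sum>i\<le>degree p. pCons 0 (monom (coeff p i) i))"
    by (simp add: op_mult_def shift smult_monom monom_Suc)
  also have "\<dots> = pCons 0 (\<Sum>i\<le>degree p. monom (coeff p i) i)"
    by (rule poly_eqI) (simp add: coeff_sum coeff_pCons split: nat.split)
  finally show ?thesis by (simp add: poly_as_sum_of_monoms)
qed

lemma calg_hom_DR_unique:
  assumes g: "g \<in> calg_hom DR_alg Sh_alg" "h \<in> calg_hom DR_alg Sh_alg"
    and eq: "g (fun_op gen1) = h (fun_op gen1)" "g (fun_op gen2) = h (fun_op gen2)"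
      "g partial_xi = h partial_xi"
    and D: "D \<in> carrier DR_alg"
  shows "g D = h D"
proof -
  have hom: "f (x + y) = f x + f y" "f (x * y) = f x * f y"
    if "f \<in> calg_hom DR_alg Sh_alg" "x \<in> carrier DR_alg" "y \<in> carrier DR_alg" for f x y
    using that by (auto simp: calg_hom_def ring_hom_def DR_alg_def DK_alg_def Sh_alg_def)
  have const: "f (fun_op (rf_const c)) = [:c:]" if f: "f \<in> calg_hom DR_alg Sh_alg" for f c
  proof -
    have sm: "\<forall>c. \<forall>D \<in> carrier DR_alg. f (c \<odot>\<^bsub>DR_alg\<^esub> D) = c \<odot>\<^bsub>Sh_alg\<^esub> f D"
      using f by (simp add: calg_hom_def)
    have "f 1 = 1"
      using f by (simp add: calg_hom_def ring_hom_def DR_alg_def DK_alg_def Sh_alg_def)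
    with bspec[OF spec[OF sm] DR_closed(2)] have "f (fun_op (rf_const c) * 1) = Polynomial.smult c 1"
      by (simp add: DR_alg_def DK_alg_def Sh_alg_def)
    then show ?thesis by (simp add: smult_one)
  qed
  have fun_op: "g (fun_op f) = h (fun_op f)" if "f \<in> coeff_ring" for f
    using that
    by (induction rule: coeff_ring.induct)
      (simp_all add: eq const[OF g(1)] const[OF g(2)] fun_op_add fun_op_mult hom[OF g(1)] hom[OF g(2)]
        fun_op_in_DR)
  have "(\<And>j. coeff p j \<in> coeff_ring) \<Longrightarrow> g (diff_op p) = h (diff_op p)" for p
  proof (induction p)
    case 0
    have "diff_op 0 = fun_op (rf_const 0)" by (simp add: fun_op_def)
    then show ?case by (simp only: const[OF g(1)] const[OF g(2)])
  next
    case (pCons f p)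
    have p: "f \<in> coeff_ring" "\<And>j. coeff p j \<in> coeff_ring"
      using pCons.prems[of 0] pCons.prems[of "Suc _"] by simp_all
    have eqp: "diff_op (pCons f p) = fun_op f + diff_op p * partial_xi"
      by (simp add: op_coeffs_inject[symmetric] diff_op_inverse op_mult_partial_right)
    have "diff_op p \<in> carrier DR_alg"
      using p by (simp add: DR_alg_def diff_op_inverse)
    then show ?case
      using p pCons.IH by (simp add: eqp hom[OF g(1)] hom[OF g(2)] fun_op eq fun_op_in_DR
          partial_xi_in_DR DR_closed)
  qed
  from this[of "op_coeffs D"] D show ?thesis
    by (simp add: DR_alg_def op_coeffs_inverse)
qed

lemma gamma_ex1:
  "\<exists>!g. g \<in> calg_hom DR_alg Sh_alg \<and> g \<in> extensional (carrier DR_alg) \<and>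
     g (fun_op gen1) = 1 \<and> g (fun_op gen2) = 1 \<and> g partial_xi = [:0, 1:] - [:rho k:]"
proof (rule ex_ex1I)
  define val where "val f = (THE c. at_inf f c)" for f
  have val: "val f = c" if "at_inf f c" for f c
    unfolding val_def using that at_inf_unique by blast
  have val_at: "at_inf f (val f)" if "f \<in> coeff_ring" for f
    using at_inf_coeff_ring[OF that] val by metis
  have val_const: "val (rf_const c) = c" for c by (rule val[OF at_inf_const])
  have val_0 [simp]: "val 0 = 0" and val_1 [simp]: "val 1 = 1"
    using val_const[of 0] val_const[of 1] by simp_all
  define X :: "complex poly" where "X = [:0, 1:] - [:rho k:]"
  define G where "G p = pcompose (map_poly val p) X" for p
  have G_0 [simp]: "G 0 = 0" and G_pCons: "G (pCons f p) = [:val f:] + X * G p" for f p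
    by (simp_all add: G_def map_poly_pCons pcompose_pCons)
  have G_1 [simp]: "G 1 = 1"
    using G_pCons[of 1 0] by (simp add: one_pCons)
  have G_add: "G (p + q) = G p + G q"
    if "\<And>j. coeff p j \<in> coeff_ring" "\<And>j. coeff q j \<in> coeff_ring" for p q
  proof -
    have "map_poly val (p + q) = map_poly val p + map_poly val q"
      using that by (intro poly_eqI) (simp add: coeff_map_poly val[OF at_inf_add] val_at)
    then show ?thesis by (simp add: G_def pcompose_add)
  qed
  have G_smult: "G (Polynomial.smult f p) = [:val f:] * G p"
    if "f \<in> coeff_ring" "\<And>j. coeff p j \<in> coeff_ring" for f p
  proof -
    have "map_poly val (Polynomial.smult f p) = Polynomial.smult (val f) (map_poly val p)"
      using that by (intro poly_eqI) (simp add: coeff_map_poly val[OF at_inf_mult] val_at)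
    then show ?thesis by (simp add: G_def pcompose_smult)
  qed
  have G_shift: "G (op_shift p) = X * G p" if p: "\<And>j. coeff p j \<in> coeff_ring" for p
  proof -
    have "map_poly val (map_poly rf_deriv p) = 0"
      using p at_inf_coeff_ring by (intro poly_eqI) (simp add: coeff_map_poly val)
    then have "G (map_poly rf_deriv p) = 0" by (simp add: G_def)
    moreover have "coeff (map_poly rf_deriv p) j \<in> coeff_ring" "coeff (pCons 0 p) j \<in> coeff_ring" for j
      using p by (auto simp: coeff_map_poly coeff_pCons coeff_ring_0 rf_deriv_coeff_ring split: nat.split)
    ultimately show ?thesis
      unfolding op_shift_def by (simp add: G_add G_pCons)
  qed
  have G_mult: "G (op_mult p q) = G p * G q"
    if "\<And>j. coeff p j \<in> coeff_ring" "\<And>j. coeff q j \<in> coeff_ring" for p q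
    using that
  proof (induction p arbitrary: q)
    case (pCons f p)
    have p: "f \<in> coeff_ring" "\<And>j. coeff p j \<in> coeff_ring"
      using pCons.prems(1)[of 0] pCons.prems(1)[of "Suc _"] by simp_all
    have 1: "coeff (op_mult p (op_shift q)) j \<in> coeff_ring" "coeff (Polynomial.smult f q) j \<in> coeff_ring" for j
      using p pCons.prems by (auto intro!: op_mult_coeff_ring op_shift_coeff_ring coeff_ring.mult)
    have "G (op_mult p (op_shift q)) = G p * (X * G q)"
      using pCons.IH[of "op_shift q"] p pCons.prems(2) by (simp add: op_shift_coeff_ring G_shift)
    then show ?case
      using p pCons.prems(2)
      by (simp add: op_mult_pCons_left G_add[OF 1(2,1)] G_smult G_pCons algebra_simps)
  qed simp
  define g where "g = restrict (\<lambda>D. G (op_coeffs D)) (carrier DR_alg)"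
  have g: "g D = G (op_coeffs D)" if "D \<in> carrier DR_alg" for D
    using that by (simp add: g_def)
  have co: "coeff (op_coeffs D) j \<in> coeff_ring" if "D \<in> carrier DR_alg" for D j
    using that by (simp add: DR_alg_def)
  have "g \<in> calg_hom DR_alg Sh_alg"
    unfolding calg_hom_def
  proof (intro CollectI conjI allI ballI ring_hom_memI)
    fix D E assume D: "D \<in> carrier DR_alg" and E: "E \<in> carrier DR_alg"
    show "g D \<in> carrier Sh_alg" by (simp add: Sh_alg_def)
    have "g (D * E) = g D * g E" "g (D + E) = g D + g E"
      using D E by (simp_all add: g DR_closed G_mult G_add co)
    then show "g (D \<otimes>\<^bsub>DR_alg\<^esub> E) = g D \<otimes>\<^bsub>Sh_alg\<^esub> g E" "g (D \<oplus>\<^bsub>DR_alg\<^esub> E) = g D \<oplus>\<^bsub>Sh_alg\<^esub> g E"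
      by (simp_all add: DR_alg_def DK_alg_def Sh_alg_def)
  next
    have "g 1 = 1" by (simp add: g DR_closed one_pCons G_pCons)
    then show "g \<one>\<^bsub>DR_alg\<^esub> = \<one>\<^bsub>Sh_alg\<^esub>" by (simp add: DR_alg_def DK_alg_def Sh_alg_def)
  next
    fix c D assume D: "D \<in> carrier DR_alg"
    have "g (fun_op (rf_const c) * D) = Polynomial.smult c (g D)"
      using D by (simp add: g DR_closed fun_op_in_DR coeff_ring.const op_mult_pCons_left G_smult co val_const)
    then show "g (c \<odot>\<^bsub>DR_alg\<^esub> D) = c \<odot>\<^bsub>Sh_alg\<^esub> g D"
      by (simp add: DR_alg_def DK_alg_def Sh_alg_def)
  qed
  moreover have "g (fun_op gen1) = 1" "g (fun_op gen2) = 1" "g partial_xi = X"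
    by (simp_all add: g fun_op_in_DR coeff_ring.gen1 coeff_ring.gen2 partial_xi_in_DR G_pCons
        val[OF at_inf_gen1] val[OF at_inf_gen2] one_pCons[symmetric])
  moreover have "g \<in> extensional (carrier DR_alg)" by (simp add: g_def)
  ultimately show "\<exists>g. g \<in> calg_hom DR_alg Sh_alg \<and> g \<in> extensional (carrier DR_alg) \<and>
     g (fun_op gen1) = 1 \<and> g (fun_op gen2) = 1 \<and> g partial_xi = [:0, 1:] - [:rho k:]"
    unfolding X_def by blast
next
  fix g h
  assume *: "g \<in> calg_hom DR_alg Sh_alg \<and> g \<in> extensional (carrier DR_alg) \<and>
     g (fun_op gen1) = 1 \<and> g (fun_op gen2) = 1 \<and> g partial_xi = [:0, 1:] - [:rho k:]"
    and **: "h \<in> calg_hom DR_alg Sh_alg \<and> h \<in> extensional (carrier DR_alg) \<and>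
     h (fun_op gen1) = 1 \<and> h (fun_op gen2) = 1 \<and> h partial_xi = [:0, 1:] - [:rho k:]"
  then have "g D = h D" if "D \<in> carrier DR_alg" for D
    using calg_hom_DR_unique[of g h D] that * ** by simp
  with * ** show "g = h"
    by (blast intro: extensionalityI)
qed

end

theory Submission
  imports Defs
begin

text \<open>
  The commutant turns out to be as small as it can be: it is \<open>\<complex>[D]\<close>, the algebra of polynomials in
  \<open>D = D_tilde k\<close> itself. This is seen on leading coefficients. Write \<open>D = \<sigma>\<partial> + A\<close> with
  \<open>\<sigma> = diag(1, -1)\<close>, and let \<open>X = X\<^sub>m\<partial>\<^sup>m + X\<^sub>m\<^sub>-\<^sub>1\<partial>\<^sup>m\<^sup>-\<^sup>1 + \<dots>\<close> commute with \<open>D\<close>. In order \<open>m + 1\<close> the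
  relation \<open>X D = D X\<close> says that \<open>X\<^sub>m\<close> commutes with \<open>\<sigma>\<close>, so \<open>X\<^sub>m\<close> is diagonal; the diagonal part of the
  relation in order \<open>m\<close> then reads \<open>z d/dz (X\<^sub>m) = 0\<close>, so \<open>X\<^sub>m\<close> is constant. Invariance under \<open>s\<close>, which
  swaps the two diagonal entries and sends \<open>\<partial>\<close> to \<open>-\<partial>\<close>, forces \<open>X\<^sub>m = c diag(1, (-1)\<^sup>m) = c \<sigma>\<^sup>m\<close>.
  This is also the leading coefficient of \<open>c D\<^sup>m\<close>, which lies in the commutant, so \<open>X - c D\<^sup>m\<close> is an
  element of the commutant of lower order, and induction applies (\<open>Dns_eq_polynomials_in_D_tilde\<close>).

  On the other side, the coefficients of \<open>D\<close> take such values at \<open>z = \<infinity>\<close> that \<open>gamma_ns k\<close> maps \<open>D\<close> to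
  an upper triangular matrix with diagonal \<open>(\<xi>, -\<xi>)\<close>. Hence \<open>p(D)\<close> is mapped to an upper triangular
  matrix with diagonal \<open>(p(\<xi>), p(-\<xi>))\<close> (\<open>gamma_ns_D_poly\<close>). On upper triangular matrices taking the
  diagonal is multiplicative, and the pairs \<open>(p(\<xi>), p(-\<xi>))\<close> are exactly the \<open>s\<close>-invariants
  of \<open>S(h) \<otimes> \<complex>\<^sup>2\<close>; both are determined by \<open>p\<close>. This gives both isomorphisms at once.
\<close>

section \<open>Constants of the derivation\<close>

lemma degree_eq_if_wronskian_0:
  fixes p q :: "'a::field_char_0 poly"
  assumes "p \<noteq> 0" "q \<noteq> 0" and eq: "pderiv p * q = p * pderiv q"
  shows "degree p = degree q"
proof -
  \<comment> \<open>Compare the coefficients of degree \<open>degree p + degree q\<close> after multiplication by \<open>x\<close>; \<open>x d/dx\<close>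
     scales each monomial by its degree, so no truncated subtraction of degrees occurs.\<close>
  have top: "coeff (pCons 0 (pderiv f) * g) (degree f + degree g) =
      of_nat (degree f) * lead_coeff f * lead_coeff g" for f g :: "'a poly"
  proof (cases "degree f = 0")
    case True
    then have "pderiv f = 0" by (simp add: pderiv_eq_0_iff)
    then show ?thesis using True by simp
  next
    case False
    then have "degree (pCons 0 (pderiv f)) = degree f"
      by (simp add: degree_pderiv pderiv_eq_0_iff)
    moreover have "coeff (pCons 0 (pderiv f)) (degree f) = of_nat (degree f) * lead_coeff f"
      using False by (cases "degree f") (simp_all add: coeff_pderiv)
    ultimately show ?thesis
      by (metis coeff_mult_degree_sum)
  qed
  have "pCons 0 (pderiv p) * q = pCons 0 (pderiv q) * p"
    using eq by (simp add: mult.commute)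
  then have "of_nat (degree p) * lead_coeff p * lead_coeff q =
      of_nat (degree q) * lead_coeff q * lead_coeff p"
    using top[of p q] top[of q p] by (metis add.commute)
  then show ?thesis using assms(1,2) by simp
qed

lemma rf_deriv_eq_0_imp_const:
  assumes "rf_deriv f = 0"
  obtains c where "f = rf_const c"
proof -
  obtain p q where f: "f = Fract p q" and q: "q \<noteq> 0" by (cases f) auto
  have "Fract (pderiv p * q - p * pderiv q) (q ^ 2) = 0"
    using assms q by (simp add: f rf_deriv_Fract)
  then have eq: "pderiv p * q = p * pderiv q"
    using q by (simp add: Zero_fract_def eq_fract)
  show thesis
  proof (cases "p = 0")
    case True
    then show thesis using that[of 0] f by (simp add: fract_collapse)
  next
    case False
    note deg = degree_eq_if_wronskian_0[OF False q eq]
    define c where "c = lead_coeff p / lead_coeff q"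
    define r where "r = p - Polynomial.smult c q"
    have "pderiv r * q = r * pderiv q"
      using eq by (simp add: r_def pderiv_diff pderiv_smult algebra_simps)
    \<comment> \<open>Subtracting \<open>c\<close> kills the leading term, yet a nonzero \<open>r\<close> would have the degree of \<open>q\<close>.\<close>
    moreover have "coeff r (degree q) = 0"
      using q deg by (simp add: r_def c_def)
    ultimately have "r = 0"
      using degree_eq_if_wronskian_0[of r q] q by (metis leading_coeff_0_iff)
    then have "f = rf_const c"
      using q by (simp add: f r_def rf_const_def eq_fract)
    then show thesis by (rule that)
  qed
qed


section \<open>Leading coefficients of differential operators\<close>

abbreviation dcoeff :: "diff_op \<Rightarrow> nat \<Rightarrow> ratfun" where
  "dcoeff D j \<equiv> coeff (op_coeffs D) j"

definition order_le :: "nat \<Rightarrow> diff_op \<Rightarrow> bool" where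
  "order_le m D \<longleftrightarrow> (\<forall>j>m. dcoeff D j = 0)"

lemma op_shift_pow_degree_le: "degree ((op_shift ^^ i) [:f:]) \<le> i"
proof (induction i)
  case (Suc i)
  have "degree (op_shift q) \<le> Suc (degree q)" for q
    by (rule degree_le) (simp add: op_shift_def coeff_pCons coeff_map_poly coeff_eq_0 split: nat.split)
  then show ?case using Suc by (metis Suc_le_mono funpow.simps(2) comp_apply order_trans)
qed simp

lemma coeff_op_shift_pow_top: "coeff ((op_shift ^^ i) [:f:]) i = f"
proof (induction i)
  case (Suc i)
  have "coeff ((op_shift ^^ i) [:f:]) (Suc i) = 0"
    by (rule coeff_eq_0) (use op_shift_pow_degree_le[of i f] in simp)
  moreover have "coeff (op_shift q) (Suc i) = coeff q i + rf_deriv (coeff q (Suc i))" for q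
    by (simp add: op_shift_def coeff_map_poly)
  ultimately show ?case using Suc by simp
qed simp

lemma dcoeff_mult_fun_op:
  assumes "order_le m D"
  shows "order_le m (D * fun_op f)" "dcoeff (D * fun_op f) m = dcoeff D m * f"
proof -
  have "degree (op_coeffs D) \<le> m"
    using assms by (intro degree_le) (simp add: order_le_def)
  then have eq: "op_coeffs (D * fun_op f) =
      (\<Sum>i\<le>m. Polynomial.smult (dcoeff D i) ((op_shift ^^ i) [:f:]))"
    by (simp add: op_mult_le)
  have low: "coeff ((op_shift ^^ i) [:f:]) j = 0" if "i < j" for i j
    by (rule coeff_eq_0) (use op_shift_pow_degree_le[of i f] that in simp)
  then show "order_le m (D * fun_op f)"
    unfolding order_le_def eq by (simp add: coeff_sum low)
  have "dcoeff (D * fun_op f) m = (\<Sum>i\<in>{m}. dcoeff D i * coeff ((op_shift ^^ i) [:f:]) m)"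
    unfolding eq coeff_sum coeff_smult by (rule sum.mono_neutral_right) (auto simp: low)
  then show "dcoeff (D * fun_op f) m = dcoeff D m * f"
    by (simp add: coeff_op_shift_pow_top)
qed

lemma dcoeff_fun_op_mult: "dcoeff (fun_op f * D) j = f * dcoeff D j"
  by (simp add: op_mult_pCons_left)

lemma dcoeff_mult_partial: "dcoeff (D * partial_xi) j = coeff (pCons 0 (op_coeffs D)) j"
  by (simp add: op_mult_partial_right)

lemma dcoeff_partial_mult:
  "dcoeff (partial_xi * D) j = coeff (pCons 0 (op_coeffs D)) j + rf_deriv (dcoeff D j)"
  by (simp add: op_mult_pCons_left op_shift_def coeff_map_poly)

lemma dcoeff_dop_s: "dcoeff (dop_s D) j = (- 1) ^ j * rf_s (dcoeff D j)"
proof -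
  have "coeff (op_s p) j = (- 1) ^ j * rf_s (coeff p j)" for p
    by (induction p arbitrary: j) (auto simp: op_s_pCons coeff_pCons split: nat.split)
  then show ?thesis by simp
qed


section \<open>Entries of the operator and membership in the commutant\<close>

text \<open>The coefficient functions \<open>a\<close> and \<open>b = s(a)\<close> of the operator in terms of the generators of
  \<open>R\<close>, using \<open>(1 - e\<^sup>\<epsilon>)\<^sup>-\<^sup>1 = 1 - (1 - e\<^sup>-\<^sup>\<epsilon>)\<^sup>-\<^sup>1\<close>.\<close>

definition upper_fun :: "complex \<times> complex \<Rightarrow> ratfun" where
  "upper_fun k = rf_const (fst k) * gen1 + rf_const (2 * snd k) * gen2"

definition lower_fun :: "complex \<times> complex \<Rightarrow> ratfun" where
  "lower_fun k = rf_const (fst k) * (1 - gen1) + rf_const (2 * snd k) * (1 - gen2)"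

lemma D_tilde_entries:
  "D_tilde k $ 1 $ 1 = partial_xi + fun_op (upper_fun k - rf_const (rho k))"
  "D_tilde k $ 1 $ 2 = - fun_op (upper_fun k)"
  "D_tilde k $ 2 $ 1 = - fun_op (lower_fun k)"
  "D_tilde k $ 2 $ 2 = - partial_xi - fun_op (upper_fun k - rf_const (rho k))"
proof -
  have gens: "inverse (1 - zz) = 1 - gen1" "inverse (1 - zz ^ 2) = 1 - gen2"
    using zz_neq_1 by (simp_all add: gen1_def gen2_def power2_eq_square field_simps)
  have two: "rf_const (2 * c) = 2 * rf_const c" for c
    by (metis mult_2 rf_const_add)
  show "D_tilde k $ 1 $ 1 = partial_xi + fun_op (upper_fun k - rf_const (rho k))"
    "D_tilde k $ 1 $ 2 = - fun_op (upper_fun k)"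
    "D_tilde k $ 2 $ 1 = - fun_op (lower_fun k)"
    "D_tilde k $ 2 $ 2 = - partial_xi - fun_op (upper_fun k - rf_const (rho k))"
    unfolding D_tilde_def Let_def divide_inverse gens gen1_def[symmetric] gen2_def[symmetric]
      upper_fun_def lower_fun_def two by simp_all
qed

lemma upper_fun_in_coeff_ring: "upper_fun k \<in> coeff_ring"
  and lower_fun_in_coeff_ring: "lower_fun k \<in> coeff_ring"
  unfolding upper_fun_def lower_fun_def
  by (intro coeff_ring.intros coeff_ring_diff coeff_ring_1)+

lemma mem_Dns_iff: "X \<in> carrier (Dns_alg k) \<longleftrightarrow>
    (\<forall>i j. X $ i $ j \<in> carrier DR_alg) \<and> mat_s X = X \<and> X ** D_tilde k = D_tilde k ** X"
  by (simp add: Dns_alg_def MDR_inv_alg_def MDR_alg_def)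

lemma Dns_ops:
  "mult (Dns_alg k) = (**)" "add (Dns_alg k) = (+)" "one (Dns_alg k) = mat 1"
  "smult (Dns_alg k) = (\<lambda>c. map_matrix (\<lambda>D. c \<odot>\<^bsub>DR_alg\<^esub> D))"
  by (simp_all add: Dns_alg_def MDR_inv_alg_def MDR_alg_def)

lemma D_tilde_in_Dns: "D_tilde k \<in> carrier (Dns_alg k)"
  using D_tilde_in_MDR_inv[of k] by (simp add: Dns_alg_def)

lemma Dns_closed:
  assumes "X \<in> carrier (Dns_alg k)" "Y \<in> carrier (Dns_alg k)"
  shows "X + Y \<in> carrier (Dns_alg k)" "X ** Y \<in> carrier (Dns_alg k)" "X - Y \<in> carrier (Dns_alg k)"
proof -
  interpret complex_algebra "Dns_alg k" by (rule complex_algebra_Dns)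
  show "X + Y \<in> carrier (Dns_alg k)" "X ** Y \<in> carrier (Dns_alg k)"
    using add.m_closed[OF assms] m_closed[OF assms] by (simp_all add: Dns_ops)
  have "(- 1) \<odot>\<^bsub>Dns_alg k\<^esub> Y = - Y"
  proof -
    have "rf_const (- 1) = - 1" by (simp add: rf_const_def fract_expand one_pCons)
    then show ?thesis
      by (simp add: Dns_ops vec_eq_iff DR_alg_def DK_alg_def fun_op_uminus)
  qed
  then have "X \<oplus>\<^bsub>Dns_alg k\<^esub> - Y \<in> carrier (Dns_alg k)"
    using assms smult_closed[of Y "- 1"] by (metis add.m_closed)
  then show "X - Y \<in> carrier (Dns_alg k)" by (simp add: Dns_ops)
qed

lemma mat_const_in_Dns: "mat (fun_op (rf_const c)) \<in> carrier (Dns_alg k)"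
proof -
  interpret complex_algebra "Dns_alg k" by (rule complex_algebra_Dns)
  have "c \<odot>\<^bsub>Dns_alg k\<^esub> mat 1 = mat (fun_op (rf_const c))"
    by (simp add: Dns_ops vec_eq_iff mat_def DR_alg_def DK_alg_def)
  then show ?thesis using smult_closed[OF one_closed, of c] by (simp add: Dns_ops)
qed


section \<open>The commutant consists of the polynomials in the operator\<close>

text \<open>Evaluation of a polynomial at the operator, by Horner's rule. The function \<open>poly\<close> cannot be used,
  since \<open>(*)\<close> is the entrywise product on matrices.\<close>

definition D_poly :: "complex \<times> complex \<Rightarrow> complex poly \<Rightarrow> dop_matrix" where
  "D_poly k p = fold_coeffs (\<lambda>c Y. mat (fun_op (rf_const c)) + D_tilde k ** Y) p 0"

lemma mat2_mult_0 [simp]: "(X :: dop_matrix) ** 0 = 0"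
  by (simp add: matrix_matrix_mult_def vec_eq_iff)

lemma mat_0_dop [simp]: "mat 0 = (0 :: dop_matrix)"
  by (simp add: mat_def vec_eq_iff)

lemma D_poly_0 [simp]: "D_poly k 0 = 0"
  by (simp add: D_poly_def)

lemma D_poly_pCons: "D_poly k (pCons c p) = mat (fun_op (rf_const c)) + D_tilde k ** D_poly k p"
  by (cases "c = 0 \<and> p = 0") (auto simp: D_poly_def)

lemma D_poly_add: "D_poly k (p + q) = D_poly k p + D_poly k q"
proof (induction p q rule: poly_induct2)
  case (pCons c p d q)
  have "mat (fun_op (rf_const (c + d))) =
      (mat (fun_op (rf_const c)) + mat (fun_op (rf_const d)) :: dop_matrix)"
    by (simp add: vec_eq_iff mat_def rf_const_add fun_op_add)
  with pCons show ?case by (simp add: D_poly_pCons matrix_add_ldistrib)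
qed simp

lemma D_poly_in_Dns: "D_poly k p \<in> carrier (Dns_alg k)"
proof (induction p)
  case 0
  show ?case using mat_const_in_Dns[of 0 k] by simp
next
  case (pCons c p)
  then show ?case
    by (simp add: D_poly_pCons Dns_closed mat_const_in_Dns D_tilde_in_Dns)
qed

lemma D_poly_monom_leading:
  shows "order_le m (D_poly k (monom c m) $ i $ j)"
    and "dcoeff (D_poly k (monom c m) $ 1 $ 1) m = rf_const c"
proof -
  define M where "M n = D_poly k (monom c n)" for n
  have M0: "M 0 = mat (fun_op (rf_const c))"
    by (simp add: M_def monom_0 D_poly_pCons)
  have MSuc: "M (Suc n) = D_tilde k ** M n" for n
    by (simp add: M_def monom_Suc D_poly_pCons)
  \<comment> \<open>The off-diagonal entries of order \<open>m\<close> do not feed into the diagonal ones of order \<open>m + 1\<close>, since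
     the off-diagonal entries of the operator have order \<open>0\<close>.\<close>
  have "(\<forall>i j. order_le m (M m $ i $ j)) \<and> dcoeff (M m $ 1 $ 1) m = rf_const c"
  proof (induction m)
    case 0
    show ?case by (auto simp: M0 mat_def order_le_def coeff_pCons split: nat.split)
  next
    case (Suc n)
    have "order_le (Suc n) (M (Suc n) $ i $ j)" for i j
      using Suc exhaust_2[of i]
      by (auto simp: order_le_def MSuc matrix_matrix_mult_def sum_2 D_tilde_entries distrib_right
          left_diff_distrib dcoeff_fun_op_mult dcoeff_partial_mult coeff_pCons
          simp del: op_coeffs_simps(6) split: nat.split)
    moreover have "dcoeff (M (Suc n) $ 1 $ 1) (Suc n) = rf_const c"
      using Suc by (auto simp: order_le_def MSuc matrix_matrix_mult_def sum_2 D_tilde_entries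
          distrib_right dcoeff_fun_op_mult dcoeff_partial_mult simp del: op_coeffs_simps(6))
    ultimately show ?case by blast
  qed
  then show "order_le m (D_poly k (monom c m) $ i $ j)"
    "dcoeff (D_poly k (monom c m) $ 1 $ 1) m = rf_const c"
    by (simp_all add: M_def)
qed

lemma ratfun_eq_uminus_self:
  fixes f :: ratfun
  assumes "- f = f"
  shows "f = 0"
proof -
  have "rf_const 2 * f = f - - f" using rf_const_add[of 1 1] by (simp add: algebra_simps)
  then have "rf_const 2 * f = 0" using assms by simp
  moreover have "rf_const 2 \<noteq> 0" by (simp add: rf_const_def Zero_fract_def eq_fract)
  ultimately show ?thesis by simp
qed

text \<open>The comparison of leading coefficients in \<open>X D = D X\<close>: the off-diagonal entries vanish by the
  relation in order \<open>m + 1\<close>. In the upper left entry the relation in order \<open>m\<close> also contains the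
  coefficient of \<open>X\<close> in order \<open>m - 1\<close>, but it occurs equally on both sides, and what remains is that the
  leading coefficient has derivative \<open>0\<close>. The lower right entry is the image of the upper left one
  under \<open>s\<close>.\<close>

lemma Dns_leading_coeffs:
  assumes X: "X \<in> carrier (Dns_alg k)" and ord: "\<And>i j. order_le m (X $ i $ j)"
  obtains c where "dcoeff (X $ 1 $ 1) m = rf_const c" "dcoeff (X $ 1 $ 2) m = 0"
    "dcoeff (X $ 2 $ 1) m = 0" "dcoeff (X $ 2 $ 2) m = (- 1) ^ m * rf_const c"
proof -
  define x y u v where "x = X $ 1 $ 1" and "y = X $ 1 $ 2" and "u = X $ 2 $ 1" and "v = X $ 2 $ 2"
  define a b e where "a = upper_fun k" and "b = lower_fun k" and "e = upper_fun k - rf_const (rho k)"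
  have xyuv: "order_le m x" "order_le m y" "order_le m u" "order_le m v"
    using ord by (simp_all add: x_def y_def u_def v_def)
  note top = xyuv[THEN dcoeff_mult_fun_op(2)] and
    above = xyuv[THEN dcoeff_mult_fun_op(1), unfolded order_le_def, rule_format, OF lessI]
    xyuv[unfolded order_le_def, rule_format, OF lessI]
  have eqs: "X ** D_tilde k = D_tilde k ** X" and inv: "mat_s X = X"
    using X by (simp_all add: mem_Dns_iff)
  have 11: "x * partial_xi + x * fun_op e - y * fun_op b
      = partial_xi * x + fun_op e * x - fun_op a * u"
    and 12: "- (x * fun_op a) - y * partial_xi - y * fun_op e
      = partial_xi * y + fun_op e * y - fun_op a * v"
    and 21: "u * partial_xi + u * fun_op e - v * fun_op b
      = - (fun_op b * x) - partial_xi * u - fun_op e * u"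
    using eqs unfolding mat2_eq_iff
    by (simp_all add: matrix_matrix_mult_def sum_2 D_tilde_entries x_def y_def u_def v_def
        a_def b_def e_def algebra_simps)
  note dcoeff_simps = dcoeff_mult_partial dcoeff_partial_mult dcoeff_fun_op_mult top above
  have "- dcoeff y m = dcoeff y m"
    using arg_cong[OF 12, of "\<lambda>D. dcoeff D (Suc m)"]
    by (simp add: dcoeff_simps del: op_coeffs_simps(6))
  then have y: "dcoeff y m = 0" by (rule ratfun_eq_uminus_self)
  have "- dcoeff u m = dcoeff u m"
    using arg_cong[OF 21, of "\<lambda>D. dcoeff D (Suc m)"]
    by (simp add: dcoeff_simps del: op_coeffs_simps(6))
  then have u: "dcoeff u m = 0" by (rule ratfun_eq_uminus_self)
  have "rf_deriv (dcoeff x m) = 0"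
    using arg_cong[OF 11, of "\<lambda>D. dcoeff D m"]
    by (simp add: dcoeff_simps y u del: op_coeffs_simps(6))
  then obtain c where c: "dcoeff x m = rf_const c" by (rule rf_deriv_eq_0_imp_const)
  have "v = dop_s x"
    using inv by (metis mat_s_entries(4) v_def x_def)
  then have "dcoeff v m = (- 1) ^ m * rf_const c"
    by (simp add: dcoeff_dop_s c del: op_coeffs_simps(9))
  with c y u show thesis
    by (intro that) (simp_all add: x_def y_def u_def v_def)
qed

theorem Dns_eq_polynomials_in_D_tilde: "carrier (Dns_alg k) = range (D_poly k)"
proof (rule subset_antisym; rule subsetI)
  fix X assume "X \<in> range (D_poly k)"
  then show "X \<in> carrier (Dns_alg k)" using D_poly_in_Dns by (metis rangeE)
next
  fix X assume X: "X \<in> carrier (Dns_alg k)"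
  have "\<exists>p. X = D_poly k p"
    if "X \<in> carrier (Dns_alg k)" "\<forall>i j. \<forall>l\<ge>m. dcoeff (X $ i $ j) l = 0" for m X
    using that
  proof (induction m arbitrary: X)
    case 0
    then have "X = D_poly k 0"
      by (simp add: vec_eq_iff op_coeffs_inject[symmetric] poly_eq_iff)
    then show ?case ..
  next
    case (Suc m)
    then have ord: "order_le m (X $ i $ j)" for i j
      by (simp add: order_le_def Suc_le_eq)
    obtain c where c: "dcoeff (X $ 1 $ 1) m = rf_const c" "dcoeff (X $ 1 $ 2) m = 0"
      "dcoeff (X $ 2 $ 1) m = 0" "dcoeff (X $ 2 $ 2) m = (- 1) ^ m * rf_const c"
      using Dns_leading_coeffs[OF Suc.prems(1) ord] by blast
    define M where "M = D_poly k (monom c m)"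
    have M: "M \<in> carrier (Dns_alg k)" "\<And>i j. order_le m (M $ i $ j)"
      "dcoeff (M $ 1 $ 1) m = rf_const c"
      by (simp_all add: M_def D_poly_in_Dns D_poly_monom_leading)
    \<comment> \<open>The other leading coefficients of \<open>M\<close> need no computation: it lies in the commutant as well.\<close>
    obtain d where d: "dcoeff (M $ 1 $ 1) m = rf_const d" "dcoeff (M $ 1 $ 2) m = 0"
      "dcoeff (M $ 2 $ 1) m = 0" "dcoeff (M $ 2 $ 2) m = (- 1) ^ m * rf_const d"
      using Dns_leading_coeffs[OF M(1,2)] by blast
    have "dcoeff ((X - M) $ i $ j) m = 0" for i j
      using exhaust_2[of i] exhaust_2[of j] c d M(3) by auto
    moreover have "dcoeff ((X - M) $ i $ j) l = 0" if "l > m" for i j l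
      using ord[of i j] M(2)[of i j] that by (simp add: order_le_def)
    ultimately have "\<forall>i j. \<forall>l\<ge>m. dcoeff ((X - M) $ i $ j) l = 0"
      by (metis le_neq_implies_less)
    then obtain p where p: "X - M = D_poly k p"
      using Suc.IH[OF Dns_closed(3)[OF Suc.prems(1) M(1)]] by blast
    then have "X = D_poly k (p + monom c m)"
      by (simp add: D_poly_add M_def[symmetric] flip: p)
    then show ?case ..
  qed
  moreover have "\<forall>i j. \<forall>l\<ge>Suc (\<Sum>i\<in>UNIV. \<Sum>j\<in>UNIV. degree (op_coeffs (X $ i $ j))).
      dcoeff (X $ i $ j) l = 0"
    by (simp add: forall_2 sum_2 coeff_eq_0)
  ultimately show "X \<in> range (D_poly k)" using X by blast
qed


section \<open>The Harish-Chandra homomorphism on the commutant\<close>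

lemma gamma_hom: "gamma k \<in> calg_hom DR_alg Sh_alg"
  and gamma_gen1: "gamma k (fun_op gen1) = 1"
  and gamma_gen2: "gamma k (fun_op gen2) = 1"
  and gamma_partial: "gamma k partial_xi = [:0, 1:] - [:rho k:]"
  using theI'[OF gamma_ex1[of k]] unfolding gamma_def by blast+

lemma gamma_smult:
  assumes "D \<in> carrier DR_alg"
  shows "gamma k (c \<odot>\<^bsub>DR_alg\<^esub> D) = Polynomial.smult c (gamma k D)"
  using gamma_hom[of k] assms by (simp add: calg_hom_def Sh_alg_def)

lemma gamma_1: "gamma k 1 = 1"
  using gamma_hom[of k] by (simp add: calg_hom_def ring_hom_def DR_alg_def DK_alg_def Sh_alg_def)

lemma gamma_add: "D \<in> carrier DR_alg \<Longrightarrow> E \<in> carrier DR_alg \<Longrightarrow> gamma k (D + E) = gamma k D + gamma k E"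
  and gamma_mult: "D \<in> carrier DR_alg \<Longrightarrow> E \<in> carrier DR_alg \<Longrightarrow> gamma k (D * E) = gamma k D * gamma k E"
  using gamma_hom[of k]
  by (simp_all add: calg_hom_def ring_hom_def DR_alg_def DK_alg_def Sh_alg_def)

lemma gamma_const: "gamma k (fun_op (rf_const c)) = [:c:]"
  using gamma_smult[OF DR_closed(2), of k c]
  by (simp add: gamma_1 DR_alg_def DK_alg_def smult_one)

lemma gamma_0: "gamma k 0 = 0"
  using gamma_const[of k 0] by simp

lemma gamma_uminus: "D \<in> carrier DR_alg \<Longrightarrow> gamma k (- D) = - gamma k D"
  using gamma_add[of D "- D" k] by (simp add: DR_closed gamma_0 add_eq_0_iff)

lemma gamma_diff: "D \<in> carrier DR_alg \<Longrightarrow> E \<in> carrier DR_alg \<Longrightarrow> gamma k (D - E) = gamma k D - gamma k E"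
  using gamma_add[of D "- E" k] by (simp add: DR_closed gamma_uminus)

lemma gamma_ns_mult:
  assumes "\<forall>i j. X $ i $ j \<in> carrier DR_alg" "\<forall>i j. Y $ i $ j \<in> carrier DR_alg"
  shows "gamma_ns k (X ** Y) = gamma_ns k X ** gamma_ns k Y"
  using assms
  by (simp add: gamma_ns_def vec_eq_iff matrix_matrix_mult_def sum_2 gamma_add gamma_mult DR_closed)

lemma gamma_ns_add:
  assumes "\<forall>i j. X $ i $ j \<in> carrier DR_alg" "\<forall>i j. Y $ i $ j \<in> carrier DR_alg"
  shows "gamma_ns k (X + Y) = gamma_ns k X + gamma_ns k Y"
  using assms by (simp add: gamma_ns_def vec_eq_iff gamma_add)

lemma gamma_ns_mat_const: "gamma_ns k (mat (fun_op (rf_const c))) = mat [:c:]"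
  by (simp add: gamma_ns_def vec_eq_iff mat_def gamma_const gamma_0)

text \<open>At \<open>z = \<infinity>\<close> the coefficient \<open>a\<close> takes the value \<open>k\<^sub>1 + 2 k\<^sub>2 = 2 \<rho>\<close> and \<open>b\<close> vanishes; the shift of \<open>\<partial>\<close> by
  \<open>\<rho>\<close> in \<open>gamma\<close> is the one for which the diagonal becomes exactly \<open>(\<xi>, -\<xi>)\<close>.\<close>

lemma gamma_ns_D_tilde:
  "gamma_ns k (D_tilde k) $ 1 $ 1 = [:0, 1:]"
  "gamma_ns k (D_tilde k) $ 2 $ 1 = 0"
  "gamma_ns k (D_tilde k) $ 2 $ 2 = [:0, - 1:]"
proof -
  note mem = fun_op_in_DR coeff_ring.intros coeff_ring_diff coeff_ring_1 upper_fun_in_coeff_ring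
    lower_fun_in_coeff_ring partial_xi_in_DR DR_closed
  have diff: "fun_op (f - g) = fun_op f - fun_op g" for f g
    by (simp add: op_coeffs_inject[symmetric])
  have "gamma k (fun_op (upper_fun k)) = [:2 * rho k:]"
    by (simp add: upper_fun_def fun_op_add fun_op_mult gamma_add gamma_mult gamma_const gamma_gen1
        gamma_gen2 mem rho_def)
  then have diagonal: "gamma k (fun_op (upper_fun k - rf_const (rho k))) = [:rho k:]"
    by (simp add: diff gamma_diff gamma_const mem)
  have lower: "gamma k (fun_op (lower_fun k)) = 0"
    by (simp add: lower_fun_def fun_op_add fun_op_mult diff gamma_add gamma_mult gamma_diff
        gamma_const gamma_gen1 gamma_gen2 gamma_1 mem)
  show "gamma_ns k (D_tilde k) $ 1 $ 1 = [:0, 1:]"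
    "gamma_ns k (D_tilde k) $ 2 $ 1 = 0"
    "gamma_ns k (D_tilde k) $ 2 $ 2 = [:0, - 1:]"
    by (simp_all add: gamma_ns_def D_tilde_entries gamma_add gamma_diff gamma_uminus gamma_partial
        diagonal lower mem)
qed

lemma gamma_ns_D_poly:
  "gamma_ns k (D_poly k p) $ 1 $ 1 = p \<and> gamma_ns k (D_poly k p) $ 2 $ 1 = 0 \<and>
   gamma_ns k (D_poly k p) $ 2 $ 2 = sh_s p"
proof (induction p)
  case 0
  show ?case by (simp add: gamma_ns_def gamma_0 sh_s_def)
next
  case (pCons c p)
  have mem: "\<forall>i j. X $ i $ j \<in> carrier DR_alg" if "X \<in> carrier (Dns_alg k)" for X
    using that by (simp add: mem_Dns_iff)
  have "gamma_ns k (D_poly k (pCons c p)) = mat [:c:] + gamma_ns k (D_tilde k) ** gamma_ns k (D_poly k p)"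
    using mem by (simp add: D_poly_pCons gamma_ns_add gamma_ns_mult gamma_ns_mat_const
        mat_const_in_Dns Dns_closed D_tilde_in_Dns D_poly_in_Dns)
  with pCons.IH show ?case
    by (simp add: matrix_matrix_mult_def sum_2 mat_def gamma_ns_D_tilde sh_s_def pcompose_pCons)
qed


section \<open>The two isomorphisms\<close>

lemma calg_iso_compose:
  assumes "f \<in> calg_iso A B" "g \<in> calg_iso B C"
  shows "g \<circ> f \<in> calg_iso A C"
proof -
  have "g \<circ> f \<in> ring_hom A C"
    using assms by (auto simp: calg_iso_def calg_hom_def intro: ring_hom_trans)
  moreover have "f x \<in> carrier B" if "x \<in> carrier A" for x
    using assms(1) that by (auto simp: calg_iso_def bij_betw_def)
  ultimately show ?thesis
    using assms by (auto simp: calg_iso_def calg_hom_def intro: bij_betw_trans)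
qed

lemma mem_Sh2_inv_iff: "P \<in> carrier Sh2_inv_alg \<longleftrightarrow> P $ 2 = sh_s (P $ 1)"
proof -
  have "sh_s (sh_s p) = p" for p
    by (simp add: sh_s_def flip: pcompose_assoc)
      (simp add: pcompose_pCons pcompose_idR)
  then show ?thesis
    by (auto simp: Sh2_inv_alg_def Sh2_alg_def sh2_s_def vec_eq_iff forall_2)
qed

text \<open>An invariant pair is determined by its first component, which is arbitrary.\<close>

lemma proj1_calg_iso: "proj1 \<in> calg_iso Sh2_inv_alg Sh_alg"
  unfolding calg_iso_def
proof (intro CollectI conjI)
  show "proj1 \<in> calg_hom Sh2_inv_alg Sh_alg"
    by (auto simp: calg_hom_def ring_hom_def proj1_def Sh2_inv_alg_def Sh2_alg_def Sh_alg_def)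
  show "bij_betw proj1 (carrier Sh2_inv_alg) (carrier Sh_alg)"
    by (rule bij_betw_byWitness[where f' = "\<lambda>p. vector [p, sh_s p]"])
      (auto simp: mem_Sh2_inv_iff proj1_def Sh_alg_def vec_eq_iff forall_2)
qed

text \<open>Multiplicativity is the point where triangularity is used, and membership of the image in the
  invariants is not inherited from that of \<open>X\<close>: \<open>gamma\<close> does not intertwine the two actions of \<open>s\<close>,
  since it evaluates at \<open>z = \<infinity>\<close> and \<open>s\<close> exchanges \<open>\<infinity>\<close> and \<open>0\<close>. Both come from the description of the
  commutant as \<open>\<complex>[D]\<close>.\<close>

lemma diag_gamma_ns_calg_iso: "diag \<circ> gamma_ns k \<in> calg_iso (Dns_alg k) Sh2_inv_alg"
proof -
  let ?\<phi> = "diag \<circ> gamma_ns k"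
  have at_poly: "?\<phi> (D_poly k p) = vector [p, sh_s p]" for p
    by (simp add: diag_def gamma_ns_D_poly)
  have poly: "\<exists>p. X = D_poly k p" if "X \<in> carrier (Dns_alg k)" for X
    using that by (auto simp: Dns_eq_polynomials_in_D_tilde)
  have triangular: "gamma_ns k X $ 2 $ 1 = 0" if "X \<in> carrier (Dns_alg k)" for X
    using poly[OF that] gamma_ns_D_poly by metis
  have entries: "\<forall>i j. X $ i $ j \<in> carrier DR_alg" if "X \<in> carrier (Dns_alg k)" for X
    using that by (simp add: mem_Dns_iff)
  have "?\<phi> \<in> calg_hom (Dns_alg k) Sh2_inv_alg"
    unfolding calg_hom_def
  proof (intro CollectI conjI allI ballI ring_hom_memI)
    fix X assume X: "X \<in> carrier (Dns_alg k)"
    show "?\<phi> X \<in> carrier Sh2_inv_alg"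
      using poly[OF X] at_poly by (auto simp: mem_Sh2_inv_iff)
    show "?\<phi> (c \<odot>\<^bsub>Dns_alg k\<^esub> X) = c \<odot>\<^bsub>Sh2_inv_alg\<^esub> ?\<phi> X" for c
      using entries[OF X]
      by (simp add: Dns_ops Sh2_inv_alg_def Sh2_alg_def diag_def gamma_ns_def vec_eq_iff forall_2
          gamma_smult)
    fix Y assume Y: "Y \<in> carrier (Dns_alg k)"
    show "?\<phi> (X \<oplus>\<^bsub>Dns_alg k\<^esub> Y) = ?\<phi> X \<oplus>\<^bsub>Sh2_inv_alg\<^esub> ?\<phi> Y"
      by (simp add: Dns_ops Sh2_inv_alg_def Sh2_alg_def diag_def vec_eq_iff forall_2
          gamma_ns_add[OF entries[OF X] entries[OF Y]])
    show "?\<phi> (X \<otimes>\<^bsub>Dns_alg k\<^esub> Y) = ?\<phi> X \<otimes>\<^bsub>Sh2_inv_alg\<^esub> ?\<phi> Y"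
      by (simp add: Dns_ops Sh2_inv_alg_def Sh2_alg_def diag_def vec_eq_iff forall_2
          gamma_ns_mult[OF entries[OF X] entries[OF Y]])
        (simp add: matrix_matrix_mult_def sum_2 triangular[OF X] triangular[OF Y])
  next
    show "?\<phi> \<one>\<^bsub>Dns_alg k\<^esub> = \<one>\<^bsub>Sh2_inv_alg\<^esub>"
      by (simp add: Dns_ops Sh2_inv_alg_def Sh2_alg_def diag_def gamma_ns_def vec_eq_iff forall_2
          mat_def gamma_1)
  qed
  moreover have "bij_betw ?\<phi> (carrier (Dns_alg k)) (carrier Sh2_inv_alg)"
  proof (rule bij_betw_byWitness[where f' = "\<lambda>P. D_poly k (P $ 1)"])
    show "\<forall>X\<in>carrier (Dns_alg k). D_poly k (?\<phi> X $ 1) = X"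
      using poly at_poly by (metis vector_2(1))
    show "\<forall>P\<in>carrier Sh2_inv_alg. ?\<phi> (D_poly k (P $ 1)) = P"
      unfolding at_poly by (simp add: mem_Sh2_inv_iff vec_eq_iff forall_2)
    show "?\<phi> ` carrier (Dns_alg k) \<subseteq> carrier Sh2_inv_alg"
      using poly at_poly by (fastforce simp: mem_Sh2_inv_iff)
    show "(\<lambda>P. D_poly k (P $ 1)) ` carrier Sh2_inv_alg \<subseteq> carrier (Dns_alg k)"
      using D_poly_in_Dns by blast
  qed
  ultimately show ?thesis by (simp add: calg_iso_def)
qed

theorem theorem6p13:
  fixes k :: "complex \<times> complex"
  shows "diag \<circ> gamma_ns k \<in> calg_iso (Dns_alg k) Sh2_inv_alg \<and>
    gamma_HC k \<in> calg_iso (Dns_alg k) Sh_alg"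
  unfolding gamma_HC_def
  using diag_gamma_ns_calg_iso calg_iso_compose[OF diag_gamma_ns_calg_iso proj1_calg_iso] by blast

end
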